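(* Let $F$ be a field of characteristic $0$ or greater than $d$, and let $n\geq d$. Then the Koszul duality functor $D:\mathrm{S}\text{-}\mathrm{Mod}\to\mathrm{S}\text{-}\mathrm{Mod}$, $D(M)=\mathrm{S}^-\otimes_{\mathrm{S}}M$, is an equivalence of categories.
   Context: $n,d$ are positive integers and $F$ is a field of characteristic different from $2$. The symmetric group $\mathbf{S}_d$ acts on $(F^n)^{\otimes d}$ by permuting tensor factors, and $\mathrm{sgn}$ is its sign character. $\mathrm{S}=\mathrm{S}_F(n,d)=\mathrm{End}_{\mathbf{S}_d}((F^n)^{\otimes d})$ is the Schur algebra and $\mathrm{S}^-=\mathrm{S}^-_F(n,d)=\mathrm{Hom}_{\mathbf{S}_d}((F^n)^{\otimes d},(F^n)^{\otimes d}\otimes\mathrm{sgn})$, an $(\mathrm{S},\mathrm{S})$-bimodule under composition. $\mathrm{S}\text{-}\mathrm{Mod}$ is the category of left $\mathrm{S}$-modules; $D(f)=\mathrm{id}_{\mathrm{S}^-}\otimes f$ on morphisms. *)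

theory Defs
  imports
    "HOL-Analysis.Finite_Cartesian_Product"
    "HOL-Combinatorics.Permutations"
    "HOL-Algebra.Free_Abelian_Groups"
    "HOL-Algebra.Module"
begin

section \<open>Categories, functors, equivalences\<close>

text \<open>
  A category is given by its family of hom-sets; these need not be disjoint, so
  composition and the action of a functor on morphisms take the objects as arguments:
  \<open>Cmp C A B E g f\<close> is the composite of \<open>f : A \<rightarrow> B\<close> and \<open>g : B \<rightarrow> E\<close>.
\<close>

record ('o, 'm) cat =
  Ob :: "'o set"
  Hom :: "'o \<Rightarrow> 'o \<Rightarrow> 'm set"
  Id :: "'o \<Rightarrow> 'm"
  Cmp :: "'o \<Rightarrow> 'o \<Rightarrow> 'o \<Rightarrow> 'm \<Rightarrow> 'm \<Rightarrow> 'm"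

definition is_category :: "('o, 'm) cat \<Rightarrow> bool" where
  "is_category C \<longleftrightarrow>
    (\<forall>A\<in>Ob C. Id C A \<in> Hom C A A) \<and>
    (\<forall>A\<in>Ob C. \<forall>B\<in>Ob C. \<forall>E\<in>Ob C. \<forall>f\<in>Hom C A B. \<forall>g\<in>Hom C B E. Cmp C A B E g f \<in> Hom C A E) \<and>
    (\<forall>A\<in>Ob C. \<forall>B\<in>Ob C. \<forall>f\<in>Hom C A B. Cmp C A A B f (Id C A) = f \<and> Cmp C A B B (Id C B) f = f) \<and>
    (\<forall>A\<in>Ob C. \<forall>B\<in>Ob C. \<forall>E\<in>Ob C. \<forall>H\<in>Ob C.
      \<forall>f\<in>Hom C A B. \<forall>g\<in>Hom C B E. \<forall>h\<in>Hom C E H.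
        Cmp C A E H h (Cmp C A B E g f) = Cmp C A B H (Cmp C B E H h g) f)"

record ('o, 'm, 'p, 'n) func =
  FOb :: "'o \<Rightarrow> 'p"
  FMor :: "'o \<Rightarrow> 'o \<Rightarrow> 'm \<Rightarrow> 'n"

definition is_func :: "('o, 'm) cat \<Rightarrow> ('p, 'n) cat \<Rightarrow> ('o, 'm, 'p, 'n) func \<Rightarrow> bool" where
  "is_func C D F \<longleftrightarrow> is_category C \<and> is_category D \<and>
    (\<forall>A\<in>Ob C. FOb F A \<in> Ob D) \<and>
    (\<forall>A\<in>Ob C. \<forall>B\<in>Ob C. \<forall>f\<in>Hom C A B. FMor F A B f \<in> Hom D (FOb F A) (FOb F B)) \<and>
    (\<forall>A\<in>Ob C. FMor F A A (Id C A) = Id D (FOb F A)) \<and>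
    (\<forall>A\<in>Ob C. \<forall>B\<in>Ob C. \<forall>E\<in>Ob C. \<forall>f\<in>Hom C A B. \<forall>g\<in>Hom C B E.
      FMor F A E (Cmp C A B E g f) =
      Cmp D (FOb F A) (FOb F B) (FOb F E) (FMor F B E g) (FMor F A B f))"

definition id_func :: "('o, 'm, 'o, 'm) func" where
  "id_func = \<lparr>FOb = (\<lambda>A. A), FMor = (\<lambda>A B f. f)\<rparr>"

definition comp_func ::
  "('p, 'n, 'q, 'k) func \<Rightarrow> ('o, 'm, 'p, 'n) func \<Rightarrow> ('o, 'm, 'q, 'k) func" where
  "comp_func G F =
    \<lparr>FOb = (\<lambda>A. FOb G (FOb F A)), FMor = (\<lambda>A B f. FMor G (FOb F A) (FOb F B) (FMor F A B f))\<rparr>"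

definition is_iso :: "('o, 'm) cat \<Rightarrow> 'o \<Rightarrow> 'o \<Rightarrow> 'm \<Rightarrow> bool" where
  "is_iso C A B f \<longleftrightarrow> f \<in> Hom C A B \<and>
    (\<exists>g\<in>Hom C B A. Cmp C A B A g f = Id C A \<and> Cmp C B A B f g = Id C B)"

definition is_nat_iso ::
  "('o, 'm) cat \<Rightarrow> ('p, 'n) cat \<Rightarrow> ('o, 'm, 'p, 'n) func \<Rightarrow> ('o, 'm, 'p, 'n) func
    \<Rightarrow> ('o \<Rightarrow> 'n) \<Rightarrow> bool" where
  "is_nat_iso C D F G \<eta> \<longleftrightarrow>
    (\<forall>A\<in>Ob C. is_iso D (FOb F A) (FOb G A) (\<eta> A)) \<and>
    (\<forall>A\<in>Ob C. \<forall>B\<in>Ob C. \<forall>f\<in>Hom C A B.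
      Cmp D (FOb F A) (FOb F B) (FOb G B) (\<eta> B) (FMor F A B f) =
      Cmp D (FOb F A) (FOb G A) (FOb G B) (FMor G A B f) (\<eta> A))"

definition is_equivalence :: "('o, 'm) cat \<Rightarrow> ('p, 'n) cat \<Rightarrow> ('o, 'm, 'p, 'n) func \<Rightarrow> bool" where
  "is_equivalence C D F \<longleftrightarrow> is_func C D F \<and>
    (\<exists>G \<eta> \<epsilon>. is_func D C G \<and>
      is_nat_iso C C id_func (comp_func G F) \<eta> \<and>
      is_nat_iso D D (comp_func F G) id_func \<epsilon>)"

section \<open>Left modules over a noncommutative ring\<close>

text \<open>
  The library locale \<open>module\<close> requires a commutative ring of scalars. Only the additive structure
  and the scalar action of a module record are meaningful; its fields \<open>mult\<close> and \<open>one\<close>, inherited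
  from the ring record, are ignored throughout.
\<close>

locale left_module = R?: Ring.ring R + M?: abelian_group M
  for R :: "('s, 'r) ring_scheme" (structure) and M :: "('s, 'a, 'q) module_scheme" (structure) +
  assumes smult_closed:
      "\<lbrakk>r \<in> carrier R; x \<in> carrier M\<rbrakk> \<Longrightarrow> r \<odot>\<^bsub>M\<^esub> x \<in> carrier M"
    and smult_l_distr:
      "\<lbrakk>r \<in> carrier R; s \<in> carrier R; x \<in> carrier M\<rbrakk> \<Longrightarrow>
        (r \<oplus>\<^bsub>R\<^esub> s) \<odot>\<^bsub>M\<^esub> x = r \<odot>\<^bsub>M\<^esub> x \<oplus>\<^bsub>M\<^esub> s \<odot>\<^bsub>M\<^esub> x"
    and smult_r_distr:
      "\<lbrakk>r \<in> carrier R; x \<in> carrier M; y \<in> carrier M\<rbrakk> \<Longrightarrow>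
        r \<odot>\<^bsub>M\<^esub> (x \<oplus>\<^bsub>M\<^esub> y) = r \<odot>\<^bsub>M\<^esub> x \<oplus>\<^bsub>M\<^esub> r \<odot>\<^bsub>M\<^esub> y"
    and smult_assoc:
      "\<lbrakk>r \<in> carrier R; s \<in> carrier R; x \<in> carrier M\<rbrakk> \<Longrightarrow>
        (r \<otimes>\<^bsub>R\<^esub> s) \<odot>\<^bsub>M\<^esub> x = r \<odot>\<^bsub>M\<^esub> (s \<odot>\<^bsub>M\<^esub> x)"
    and smult_one:
      "x \<in> carrier M \<Longrightarrow> \<one>\<^bsub>R\<^esub> \<odot>\<^bsub>M\<^esub> x = x"

text \<open>Homomorphisms are \<open>undefined\<close> outside the carrier, so that equality of morphisms is equality.\<close>

definition left_module_hom ::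
  "('s, 'r) ring_scheme \<Rightarrow> ('s, 'a) module \<Rightarrow> ('s, 'b) module \<Rightarrow> ('a \<Rightarrow> 'b) set" where
  "left_module_hom R M N = {f \<in> carrier M \<rightarrow>\<^sub>E carrier N.
    (\<forall>x\<in>carrier M. \<forall>y\<in>carrier M. f (x \<oplus>\<^bsub>M\<^esub> y) = f x \<oplus>\<^bsub>N\<^esub> f y) \<and>
    (\<forall>r\<in>carrier R. \<forall>x\<in>carrier M. f (r \<odot>\<^bsub>M\<^esub> x) = r \<odot>\<^bsub>N\<^esub> f x)}"

text \<open>The category of left \<open>R\<close>-modules whose underlying set is a subset of the type \<open>'u\<close>.\<close>

definition left_module_cat :: "('s, 'r) ring_scheme \<Rightarrow> (('s, 'u) module, 'u \<Rightarrow> 'u) cat" where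
  "left_module_cat R =
    \<lparr>Ob = {M. left_module R M},
     Hom = left_module_hom R,
     Id = (\<lambda>M. \<lambda>x\<in>carrier M. x),
     Cmp = (\<lambda>L M N g f. compose (carrier L) g f)\<rparr>"

section \<open>Tensor product over a noncommutative ring\<close>

text \<open>
  \<open>B \<otimes>\<^sub>R M\<close> for an \<open>(R,R)\<close>-bimodule \<open>B\<close> and a left \<open>R\<close>-module \<open>M\<close>: the quotient of the free abelian
  group on \<open>B \<times> M\<close> by the subgroup generated by the biadditivity and balancing relations.
  The left action on \<open>B\<close> is the one of the module record, the right action is the extra argument
  \<open>ract\<close>. The elements of the tensor product are cosets.
\<close>

abbreviation tensor_free :: "('s, 'b) module \<Rightarrow> ('s, 'a) module \<Rightarrow> ('b \<times> 'a \<Rightarrow>\<^sub>0 int) monoid" where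
  "tensor_free B M \<equiv> free_Abelian_group (carrier B \<times> carrier M)"

definition tensor_relations ::
  "('s, 'r) ring_scheme \<Rightarrow> ('s, 'b) module \<Rightarrow> ('b \<Rightarrow> 's \<Rightarrow> 'b) \<Rightarrow> ('s, 'a) module
    \<Rightarrow> ('b \<times> 'a \<Rightarrow>\<^sub>0 int) set" where
  "tensor_relations R B ract M =
    {frag_of (b \<oplus>\<^bsub>B\<^esub> b', x) - frag_of (b, x) - frag_of (b', x) |b b' x.
      b \<in> carrier B \<and> b' \<in> carrier B \<and> x \<in> carrier M} \<union>
    {frag_of (b, x \<oplus>\<^bsub>M\<^esub> x') - frag_of (b, x) - frag_of (b, x') |b x x'.
      b \<in> carrier B \<and> x \<in> carrier M \<and> x' \<in> carrier M} \<union>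
    {frag_of (ract b r, x) - frag_of (b, r \<odot>\<^bsub>M\<^esub> x) |b r x.
      b \<in> carrier B \<and> r \<in> carrier R \<and> x \<in> carrier M}"

definition tensor_null ::
  "('s, 'r) ring_scheme \<Rightarrow> ('s, 'b) module \<Rightarrow> ('b \<Rightarrow> 's \<Rightarrow> 'b) \<Rightarrow> ('s, 'a) module
    \<Rightarrow> ('b \<times> 'a \<Rightarrow>\<^sub>0 int) set" where
  "tensor_null R B ract M = generate (tensor_free B M) (tensor_relations R B ract M)"

text \<open>
  If \<open>\<phi>\<close> sends pairs to pairs and its additive extension respects the relations, this sends the
  coset of \<open>\<Sum> (b, x)\<close> to the coset, modulo \<open>H\<close>, of \<open>\<Sum> \<phi> (b, x)\<close>; the union is over equal cosets.
\<close>

definition tensor_induced ::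
  "('c \<times> 'd \<Rightarrow>\<^sub>0 int) set \<Rightarrow> ('b \<times> 'a \<Rightarrow> 'c \<times> 'd) \<Rightarrow> ('b \<times> 'a \<Rightarrow>\<^sub>0 int) set
    \<Rightarrow> ('c \<times> 'd \<Rightarrow>\<^sub>0 int) set" where
  "tensor_induced H \<phi> X =
    (\<Union>z\<in>X. H #>\<^bsub>free_Abelian_group UNIV\<^esub> frag_extend (\<lambda>p. frag_of (\<phi> p)) z)"

definition tensor_module ::
  "('s, 'r) ring_scheme \<Rightarrow> ('s, 'b) module \<Rightarrow> ('b \<Rightarrow> 's \<Rightarrow> 'b) \<Rightarrow> ('s, 'a) module
    \<Rightarrow> ('s, ('b \<times> 'a \<Rightarrow>\<^sub>0 int) set) module" where
  "tensor_module R B ract M =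
    (let Q = tensor_free B M Mod tensor_null R B ract M in
      \<lparr>carrier = carrier Q, mult = undefined, one = undefined,
       zero = one Q, add = mult Q,
       smult = (\<lambda>r. tensor_induced (tensor_null R B ract M) (\<lambda>(b, x). (r \<odot>\<^bsub>B\<^esub> b, x)))\<rparr>)"

text \<open>The map \<open>id \<otimes> f\<close> into \<open>B \<otimes>\<^sub>R N\<close>.\<close>

definition tensor_map ::
  "('s, 'r) ring_scheme \<Rightarrow> ('s, 'b) module \<Rightarrow> ('b \<Rightarrow> 's \<Rightarrow> 'b) \<Rightarrow> ('s, 'c) module
    \<Rightarrow> ('a \<Rightarrow> 'c) \<Rightarrow> ('b \<times> 'a \<Rightarrow>\<^sub>0 int) set \<Rightarrow> ('b \<times> 'c \<Rightarrow>\<^sub>0 int) set" where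
  "tensor_map R B ract N f = tensor_induced (tensor_null R B ract N) (\<lambda>(b, x). (b, f x))"

text \<open>
  The functor \<open>B \<otimes>\<^sub>R -\<close> as an endofunctor of the modules on subsets of \<open>'u\<close>: the carrier of a
  tensor product is not a subset of \<open>'u\<close>, so it is replaced by an isomorphic copy along a chosen
  injection. Such an injection exists for all \<open>M\<close> as soon as \<open>'u\<close> is infinite and at least as large
  as the carrier of \<open>B\<close>.
\<close>

definition universe_code :: "'x set \<Rightarrow> 'x \<Rightarrow> 'u" where
  "universe_code X = (SOME e. inj_on e X)"

definition transport_module :: "('x \<Rightarrow> 'u) \<Rightarrow> ('s, 'x) module \<Rightarrow> ('s, 'u) module" where
  "transport_module e N =
    (let d = inv_into (carrier N) e in
      \<lparr>carrier = e ` carrier N, mult = undefined, one = undefined,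
       zero = e \<zero>\<^bsub>N\<^esub>, add = (\<lambda>x y. e (d x \<oplus>\<^bsub>N\<^esub> d y)),
       smult = (\<lambda>r x. e (r \<odot>\<^bsub>N\<^esub> d x))\<rparr>)"

definition tensor_functor ::
  "('s, 'r) ring_scheme \<Rightarrow> ('s, 'b) module \<Rightarrow> ('b \<Rightarrow> 's \<Rightarrow> 'b)
    \<Rightarrow> (('s, 'u) module, 'u \<Rightarrow> 'u, ('s, 'u) module, 'u \<Rightarrow> 'u) func" where
  "tensor_functor R B ract =
    (let T = tensor_module R B ract; e = (\<lambda>M. universe_code (carrier (T M))) in
      \<lparr>FOb = (\<lambda>M. transport_module (e M) (T M)),
       FMor = (\<lambda>M N f. \<lambda>y\<in>e M ` carrier (T M).
         e N (tensor_map R B ract N f (inv_into (carrier (T M)) (e M) y)))\<rparr>)"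

section \<open>The Schur algebra and its signed bimodule\<close>

text \<open>
  \<open>n = CARD('n)\<close> and \<open>d = CARD('d)\<close>. The tensor power \<open>(F\<^sup>n)\<^sup>\<otimes>\<^sup>d\<close> is the space of families of
  coordinates with respect to the basis \<open>e\<^bsub>i 1\<^esub> \<otimes> \<dots> \<otimes> e\<^bsub>i d\<^esub>\<close> indexed by the maps \<open>i :: 'd \<Rightarrow> 'n\<close>;
  \<open>pure_tensor_universal\<close> below shows that it has the universal property of the tensor power.
\<close>

type_synonym ('f, 'n, 'd) tensor_power = "('f, 'd \<Rightarrow> 'n) vec"

definition pure_tensor :: "('d::finite \<Rightarrow> ('f::field) ^ 'n::finite) \<Rightarrow> ('f, 'n, 'd) tensor_power" where
  "pure_tensor v = (\<chi> i. \<Prod>k\<in>UNIV. v k $ i k)"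

text \<open>The left action of the symmetric group by place permutations; see \<open>place_perm_pure_tensor\<close>.\<close>

definition place_perm ::
  "('d \<Rightarrow> 'd) \<Rightarrow> ('f::field, 'n::finite, 'd::finite) tensor_power \<Rightarrow> ('f, 'n, 'd) tensor_power" where
  "place_perm \<sigma> x = (\<chi> i. x $ (i \<circ> \<sigma>))"

definition signed_place_perm ::
  "('d \<Rightarrow> 'd) \<Rightarrow> ('f::field, 'n::finite, 'd::finite) tensor_power \<Rightarrow> ('f, 'n, 'd) tensor_power" where
  "signed_place_perm \<sigma> x = of_int (sign \<sigma>) *s place_perm \<sigma> x"

definition equivariant_hom ::
  "(('d \<Rightarrow> 'd) \<Rightarrow> ('f::field) ^ 'k::finite \<Rightarrow> 'f ^ 'k) \<Rightarrow> (('d \<Rightarrow> 'd) \<Rightarrow> 'f ^ 'l::finite \<Rightarrow> 'f ^ 'l)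
    \<Rightarrow> ('f ^ 'k \<Rightarrow> 'f ^ 'l) set" where
  "equivariant_hom \<rho> \<rho>' =
    {h. Vector_Spaces.linear (*s) (*s) h \<and> (\<forall>\<sigma>. \<sigma> permutes UNIV \<longrightarrow> (\<forall>x. h (\<rho> \<sigma> x) = \<rho>' \<sigma> (h x)))}"

type_synonym ('f, 'n, 'd) tensor_endo =
  "('f, 'n, 'd) tensor_power \<Rightarrow> ('f, 'n, 'd) tensor_power"

definition schur_algebra :: "('f::field, 'n::finite, 'd::finite) tensor_endo ring" where
  "schur_algebra =
    \<lparr>carrier = equivariant_hom place_perm place_perm,
     mult = (\<lambda>g h. g \<circ> h), one = id,
     zero = (\<lambda>x. 0), add = (\<lambda>g h x. g x + h x)\<rparr>"

definition schur_minus ::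
  "(('f::field, 'n::finite, 'd::finite) tensor_endo, ('f, 'n, 'd) tensor_endo) module" where
  "schur_minus =
    \<lparr>carrier = equivariant_hom place_perm signed_place_perm,
     mult = undefined, one = undefined,
     zero = (\<lambda>x. 0), add = (\<lambda>g h x. g x + h x),
     smult = (\<lambda>s h. s \<circ> h)\<rparr>"

definition koszul_duality_functor ::
  "((('f::field, 'n::finite, 'd::finite) tensor_endo, 'u) module, 'u \<Rightarrow> 'u,
    (('f, 'n, 'd) tensor_endo, 'u) module, 'u \<Rightarrow> 'u) func" where
  "koszul_duality_functor = tensor_functor schur_algebra schur_minus (\<lambda>h s. h \<circ> s)"

subsection \<open>Adequacy of the model of the tensor power\<close>

lemma place_perm_pure_tensor:
  assumes "\<sigma> permutes UNIV"
  shows "place_perm \<sigma> (pure_tensor v) = pure_tensor (v \<circ> inv_into UNIV \<sigma>)"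
proof -
  have b: "bij \<sigma>" using assms by (rule permutes_bij)
  have "(\<Prod>k\<in>UNIV. v k $ i (\<sigma> k)) = (\<Prod>k\<in>UNIV. v (inv_into UNIV \<sigma> k) $ i k)" for i
    using prod.reindex_bij_betw[OF b, of "\<lambda>k. v (inv_into UNIV \<sigma> k) $ i k"]
    by (simp add: inv_f_f[OF bij_is_inj[OF b]])
  then show ?thesis
    by (simp add: place_perm_def pure_tensor_def vec_eq_iff)
qed

lemma multilinear_expand:
  fixes scale :: "'f::field \<Rightarrow> 'v::ab_group_add \<Rightarrow> 'v"
    and g :: "('d::finite \<Rightarrow> ('f::field) ^ 'n::finite) \<Rightarrow> 'v"
  assumes "\<And>v k. Vector_Spaces.linear (*s) scale (\<lambda>x. g (v(k := x)))"
  shows "g v = (\<Sum>i\<in>UNIV. scale (\<Prod>k\<in>UNIV. v k $ i k) (g (\<lambda>k. axis (i k) 1)))"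
proof -
  interpret W: vector_space scale
    using assms[of undefined undefined] by (rule Vector_Spaces.linear.axioms)
  have "g v = (\<Sum>i\<in>PiE K (\<lambda>_. UNIV). scale (\<Prod>k\<in>K. v k $ i k)
      (g (\<lambda>k. if k \<in> K then axis (i k) 1 else v k)))" if "finite K" for K :: "'d set"
    using that
  proof (induction K rule: finite_induct)
    case (insert a K)
    have step: "g (\<lambda>k. if k \<in> K then axis (i k) 1 else v k) =
      (\<Sum>j\<in>UNIV. scale (v a $ j) (g (\<lambda>k. if k \<in> insert a K then axis ((i(a := j)) k) 1 else v k)))" for i
    proof -
      let ?w = "\<lambda>k. if k \<in> K then axis (i k) 1 else v k"
      interpret L: Vector_Spaces.linear "(*s)" scale "\<lambda>x. g (?w(a := x))"
        by (rule assms)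
      have "?w = ?w(a := v a)" using insert by auto
      then have "g ?w = g (?w(a := v a))" by metis
      also have "v a = (\<Sum>j\<in>UNIV. v a $ j *s axis j 1)"
        by (metis basis_expansion)
      also have "g (?w(a := (\<Sum>j\<in>UNIV. v a $ j *s axis j 1))) =
        (\<Sum>j\<in>UNIV. scale (v a $ j) (g (?w(a := axis j 1))))"
        by (simp add: L.sum L.scale)
      also have "\<dots> = (\<Sum>j\<in>UNIV. scale (v a $ j)
          (g (\<lambda>k. if k \<in> insert a K then axis ((i(a := j)) k) 1 else v k)))"
        using insert by (intro sum.cong refl arg_cong2[where f = scale] arg_cong[where f = g]) auto
      finally show ?thesis .
    qed
    have "(\<Sum>i\<in>PiE (insert a K) (\<lambda>_. UNIV). scale (\<Prod>k\<in>insert a K. v k $ i k)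
        (g (\<lambda>k. if k \<in> insert a K then axis (i k) 1 else v k))) =
      (\<Sum>(j, i)\<in>UNIV \<times> PiE K (\<lambda>_. UNIV). scale (\<Prod>k\<in>insert a K. v k $ (i(a := j)) k)
        (g (\<lambda>k. if k \<in> insert a K then axis ((i(a := j)) k) 1 else v k)))"
      unfolding PiE_insert_eq
      by (subst sum.reindex) (use insert in \<open>auto intro!: sum.cong intro: inj_combinator\<close>)
    also have "\<dots> = (\<Sum>i\<in>PiE K (\<lambda>_. UNIV). \<Sum>j\<in>UNIV. scale (\<Prod>k\<in>K. v k $ i k) (scale (v a $ j)
        (g (\<lambda>k. if k \<in> insert a K then axis ((i(a := j)) k) 1 else v k))))"
      unfolding sum.cartesian_product[symmetric]
    proof (subst sum.swap, intro sum.cong refl)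
      fix i j
      have "(\<Prod>k\<in>insert a K. v k $ (i(a := j)) k) = v a $ j * (\<Prod>k\<in>K. v k $ (i(a := j)) k)"
        using insert by simp
      also have "(\<Prod>k\<in>K. v k $ (i(a := j)) k) = (\<Prod>k\<in>K. v k $ i k)"
        using insert by (intro prod.cong) auto
      finally show "scale (\<Prod>k\<in>insert a K. v k $ (i(a := j)) k)
          (g (\<lambda>k. if k \<in> insert a K then axis ((i(a := j)) k) 1 else v k)) =
        scale (\<Prod>k\<in>K. v k $ i k) (scale (v a $ j)
          (g (\<lambda>k. if k \<in> insert a K then axis ((i(a := j)) k) 1 else v k)))"
        by (simp only: W.scale_scale mult.commute)
    qed
    also have "\<dots> = g v"
      unfolding W.scale_sum_right[symmetric] step[symmetric] insert.IH[symmetric] ..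
    finally show ?case ..
  qed simp
  from this[of UNIV] show ?thesis by simp
qed

theorem pure_tensor_universal:
  fixes scale :: "'f::field \<Rightarrow> 'v::ab_group_add \<Rightarrow> 'v"
    and g :: "('d::finite \<Rightarrow> ('f::field) ^ 'n::finite) \<Rightarrow> 'v"
  assumes "\<And>v k. Vector_Spaces.linear (*s) scale (\<lambda>x. g (v(k := x)))"
  shows "\<exists>!h. Vector_Spaces.linear (*s) scale h \<and> (\<forall>v. h (pure_tensor v) = g v)"
proof -
  interpret W: vector_space scale
    using assms[of undefined undefined] by (rule Vector_Spaces.linear.axioms)
  let ?h = "\<lambda>x::('f, 'n, 'd) tensor_power. \<Sum>i\<in>UNIV. scale (x $ i) (g (\<lambda>k. axis (i k) 1))"
  have ax: "pure_tensor (\<lambda>k. axis (i k) 1 :: 'f ^ 'n) = axis i 1" for i :: "'d \<Rightarrow> 'n"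
    by (auto simp: pure_tensor_def vec_eq_iff axis_def fun_eq_iff)
  show ?thesis
  proof (intro ex1I[of _ ?h] conjI allI)
    show "Vector_Spaces.linear (*s) scale ?h"
      by unfold_locales
        (auto simp: vector_add_ldistrib vector_sadd_rdistrib vector_smult_assoc W.scale_left_distrib sum.distrib W.scale_sum_right simp del: W.scale_scale
          simp flip: W.scale_scale)
    show "?h (pure_tensor v) = g v" for v
      by (subst multilinear_expand[OF assms, of v]) (simp add: pure_tensor_def)
  next
    fix h assume h: "Vector_Spaces.linear (*s) scale h \<and> (\<forall>v. h (pure_tensor v) = g v)"
    then interpret L: Vector_Spaces.linear "(*s)" scale h by blast
    show "h = ?h"
    proof
      fix x
      have "h x = h (\<Sum>i\<in>UNIV. x $ i *s axis i 1)" by (metis basis_expansion)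
      also have "\<dots> = ?h x"
        using h by (simp add: L.sum L.scale flip: ax)
      finally show "h x = ?h x" .
    qed
  qed
qed

end

theory Submission
  imports Defs "HOL-Analysis.Cartesian_Space" "HOL-Computational_Algebra.Primes"
begin

text \<open>
  Composing two elements of \<open>S\<^sup>-\<close> gives an element of the Schur algebra \<open>S\<close>, because the two signs
  cancel. Composition thus defines a homomorphism of bimodules \<open>S\<^sup>- \<otimes>\<^sub>S S\<^sup>- \<rightarrow> S\<close>, and with it a Morita
  context in which both rings are \<open>S\<close> and both bimodules are \<open>S\<^sup>-\<close>. As soon as this homomorphism is
  surjective, that is, \<open>1 = \<Sum>\<^sub>i p\<^sub>i \<circ> q\<^sub>i\<close> for finitely many \<open>p\<^sub>i, q\<^sub>i \<in> S\<^sup>-\<close>, the functor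
  \<open>S\<^sup>- \<otimes>\<^sub>S -\<close> is its own quasi-inverse: the natural map \<open>b \<otimes> (b' \<otimes> m) \<mapsto> (b \<circ> b') m\<close> has the inverse
  \<open>m \<mapsto> \<Sum>\<^sub>i p\<^sub>i \<otimes> (q\<^sub>i \<otimes> m)\<close>. This is \<open>tensor_functor_equivalence\<close>.

  The elements \<open>p\<^sub>i, q\<^sub>i\<close> are explicit. Let \<open>e i\<close>, for \<open>i : {1..d} \<rightarrow> {1..n}\<close>, be the basis vectors of
  the tensor power, and for \<open>p, q : {1..d} \<rightarrow> {1..n}\<close> let \<open>t p q\<close> (\<open>signed_transfer p q\<close>) be the element
  \<open>x \<mapsto> \<Sum>\<^sub>\<sigma> sgn(\<sigma>) x(p \<circ> \<sigma>) e(q \<circ> \<sigma>)\<close> of \<open>S\<^sup>-\<close>. As \<open>n \<ge> d\<close>, there is an injective \<open>\<iota>\<close>; its orbit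
  spans a copy of the regular representation, which is isomorphic to its own twist by the sign. A
  direct computation gives \<open>\<Sum>\<^sub>j t \<iota> j \<circ> t j \<iota> = d!\<close> (\<open>sum_signed_transfer\<close>), and \<open>d!\<close> is invertible by
  the assumption on the characteristic.

  The remaining work is to derive the usual properties of the tensor product (pure tensors generate,
  balanced maps factor uniquely, functoriality) for the model by cosets, and to carry them over to
  its copies inside the type \<open>'u\<close>; such copies exist because \<open>S\<^sup>-\<close> is no larger than \<open>'u\<close>.
\<close>

section \<open>Additive and linear maps\<close>

text \<open>
  The additive maps between two modules or rings, as homomorphisms of the underlying groups.
\<close>

abbreviation add_hom ::
  "('a, 'q) ring_scheme \<Rightarrow> ('b, 'p) ring_scheme \<Rightarrow> ('a \<Rightarrow> 'b) set" where
  "add_hom M N \<equiv> hom (add_monoid M) (add_monoid N)"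

lemma add_hom_iff:
  "h \<in> add_hom M N \<longleftrightarrow> (\<forall>x\<in>carrier M. h x \<in> carrier N) \<and>
    (\<forall>x\<in>carrier M. \<forall>y\<in>carrier M. h (x \<oplus>\<^bsub>M\<^esub> y) = h x \<oplus>\<^bsub>N\<^esub> h y)"
  by (auto simp: hom_def)

lemma add_homI:
  assumes "\<And>x. x \<in> carrier M \<Longrightarrow> h x \<in> carrier N"
    and "\<And>x y. \<lbrakk>x \<in> carrier M; y \<in> carrier M\<rbrakk> \<Longrightarrow> h (x \<oplus>\<^bsub>M\<^esub> y) = h x \<oplus>\<^bsub>N\<^esub> h y"
  shows "h \<in> add_hom M N"
  using assms by (simp add: add_hom_iff)

lemma add_hom_closed: "\<lbrakk>h \<in> add_hom M N; x \<in> carrier M\<rbrakk> \<Longrightarrow> h x \<in> carrier N"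
  and add_hom_add: "\<lbrakk>h \<in> add_hom M N; x \<in> carrier M; y \<in> carrier M\<rbrakk> \<Longrightarrow>
    h (x \<oplus>\<^bsub>M\<^esub> y) = h x \<oplus>\<^bsub>N\<^esub> h y"
  by (simp_all add: add_hom_iff)

lemma add_hom_comp: "\<lbrakk>h \<in> add_hom M N; g \<in> add_hom L M\<rbrakk> \<Longrightarrow> (\<lambda>x. h (g x)) \<in> add_hom L N"
  by (simp add: add_hom_iff)

lemma add_hom_plus:
  assumes "abelian_group N" and "g \<in> add_hom M N" and "h \<in> add_hom M N"
  shows "(\<lambda>x. g x \<oplus>\<^bsub>N\<^esub> h x) \<in> add_hom M N"
proof -
  interpret N: abelian_group N by fact
  show ?thesis
    using assms(2,3) by (simp add: add_hom_iff N.a_ac)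
qed

lemma left_module_hom_iff:
  "f \<in> left_module_hom R M N \<longleftrightarrow> f \<in> add_hom M N \<and> f \<in> extensional (carrier M) \<and>
    (\<forall>r\<in>carrier R. \<forall>x\<in>carrier M. f (r \<odot>\<^bsub>M\<^esub> x) = r \<odot>\<^bsub>N\<^esub> f x)"
  by (auto simp: left_module_hom_def add_hom_iff PiE_def)

lemma left_module_hom_smult:
  "\<lbrakk>f \<in> left_module_hom R M N; r \<in> carrier R; x \<in> carrier M\<rbrakk> \<Longrightarrow>
    f (r \<odot>\<^bsub>M\<^esub> x) = r \<odot>\<^bsub>N\<^esub> f x"
  by (simp add: left_module_hom_iff)

lemma left_module_hom_ext:
  assumes "f \<in> left_module_hom R M N" "g \<in> left_module_hom R M N"
    and "\<And>x. x \<in> carrier M \<Longrightarrow> f x = g x"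
  shows "f = g"
  using assms by (intro extensionalityI[of f "carrier M"]) (auto simp: left_module_hom_iff)

lemma left_module_hom_add_hom: "f \<in> left_module_hom R M N \<Longrightarrow> f \<in> add_hom M N"
  by (simp add: left_module_hom_iff)

lemma left_module_hom_comp:
  assumes "left_module R L" "f \<in> left_module_hom R L M" "g \<in> left_module_hom R M N"
  shows "compose (carrier L) g f \<in> left_module_hom R L N"
proof -
  interpret L: left_module R L by fact
  show ?thesis
    using assms(2,3) by (auto simp: left_module_hom_iff add_hom_iff compose_eq L.smult_closed)
qed

lemma left_module_hom_id:
  assumes "left_module R M"
  shows "(\<lambda>x\<in>carrier M. x) \<in> left_module_hom R M M"
proof -
  interpret M: left_module R M by fact
  show ?thesis by (simp add: left_module_hom_iff add_hom_iff M.smult_closed)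
qed

lemma is_category_left_module_cat: "is_category (left_module_cat R)"
  unfolding is_category_def left_module_cat_def cat.simps mem_Collect_eq
proof (intro conjI ballI; (unfold mem_Collect_eq)?)
  fix M N f assume MN: "left_module R M" "left_module R N" and f: "f \<in> left_module_hom R M N"
  show "compose (carrier M) f (\<lambda>x\<in>carrier M. x) = f"
    using f
    by (intro left_module_hom_ext[OF
          left_module_hom_comp[OF MN(1) left_module_hom_id[OF MN(1)] f] f])
      (simp add: compose_eq)
  show "compose (carrier M) (\<lambda>x\<in>carrier N. x) f = f"
    by (intro left_module_hom_ext[OF
          left_module_hom_comp[OF MN(1) f left_module_hom_id[OF MN(2)]] f])
      (simp add: compose_eq add_hom_closed[OF left_module_hom_add_hom[OF f]])
next
  fix L M N P f g h
  assume f: "f \<in> left_module_hom R L M"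
  then show "compose (carrier L) h (compose (carrier L) g f) =
      compose (carrier L) (compose (carrier M) h g) f"
    by (auto simp: compose_def fun_eq_iff add_hom_closed[OF left_module_hom_add_hom[OF f]])
qed (simp_all add: left_module_hom_id left_module_hom_comp)

section \<open>The tensor product over a noncommutative ring\<close>

text \<open>
  An \<open>(R,R)\<close>-bimodule: the left action is the one of the module record, the right action is \<open>ract\<close>.
\<close>

locale bimodule = left_module R B
  for R :: "('s, 'r) ring_scheme" (structure) and B :: "('s, 'b) module" (structure) +
  fixes ract :: "'b \<Rightarrow> 's \<Rightarrow> 'b"
  assumes ract_closed: "\<lbrakk>b \<in> carrier B; r \<in> carrier R\<rbrakk> \<Longrightarrow> ract b r \<in> carrier B"
    and ract_l_distr: "\<lbrakk>b \<in> carrier B; b' \<in> carrier B; r \<in> carrier R\<rbrakk> \<Longrightarrow>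
      ract (b \<oplus>\<^bsub>B\<^esub> b') r = ract b r \<oplus>\<^bsub>B\<^esub> ract b' r"
    and ract_r_distr: "\<lbrakk>b \<in> carrier B; r \<in> carrier R; s \<in> carrier R\<rbrakk> \<Longrightarrow>
      ract b (r \<oplus>\<^bsub>R\<^esub> s) = ract b r \<oplus>\<^bsub>B\<^esub> ract b s"
    and ract_assoc: "\<lbrakk>b \<in> carrier B; r \<in> carrier R; s \<in> carrier R\<rbrakk> \<Longrightarrow>
      ract b (r \<otimes>\<^bsub>R\<^esub> s) = ract (ract b r) s"
    and ract_one: "b \<in> carrier B \<Longrightarrow> ract b \<one>\<^bsub>R\<^esub> = b"
    and smult_ract: "\<lbrakk>b \<in> carrier B; r \<in> carrier R; s \<in> carrier R\<rbrakk> \<Longrightarrow>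
      ract (r \<odot>\<^bsub>B\<^esub> b) s = r \<odot>\<^bsub>B\<^esub> ract b s"

text \<open>
  Biadditive maps \<open>B \<times> M \<rightarrow> N\<close> that identify \<open>(b r, x)\<close> with \<open>(b, r x)\<close>: the maps that factor
  through \<open>B \<otimes>\<^sub>R M\<close>. Only the additive structure of \<open>N\<close> matters.
\<close>

definition balanced ::
  "('s, 'r) ring_scheme \<Rightarrow> ('s, 'b) module \<Rightarrow> ('b \<Rightarrow> 's \<Rightarrow> 'b) \<Rightarrow> ('s, 'a) module
    \<Rightarrow> ('s, 'c) module \<Rightarrow> ('b \<Rightarrow> 'a \<Rightarrow> 'c) \<Rightarrow> bool" where
  "balanced R B ract M N g \<longleftrightarrow>
    (\<forall>x\<in>carrier M. (\<lambda>b. g b x) \<in> add_hom B N) \<and>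
    (\<forall>b\<in>carrier B. g b \<in> add_hom M N) \<and>
    (\<forall>b\<in>carrier B. \<forall>r\<in>carrier R. \<forall>x\<in>carrier M. g (ract b r) x = g b (r \<odot>\<^bsub>M\<^esub> x))"

lemma balanced_left: "\<lbrakk>balanced R B ract M N g; x \<in> carrier M\<rbrakk> \<Longrightarrow> (\<lambda>b. g b x) \<in> add_hom B N"
  and balanced_right: "\<lbrakk>balanced R B ract M N g; b \<in> carrier B\<rbrakk> \<Longrightarrow> g b \<in> add_hom M N"
  and balanced_swap: "\<lbrakk>balanced R B ract M N g; b \<in> carrier B; r \<in> carrier R; x \<in> carrier M\<rbrakk> \<Longrightarrow>
      g (ract b r) x = g b (r \<odot>\<^bsub>M\<^esub> x)"
  and balanced_closed: "\<lbrakk>balanced R B ract M N g; b \<in> carrier B; x \<in> carrier M\<rbrakk> \<Longrightarrow> g b x \<in> carrier N"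
  by (auto simp: balanced_def add_hom_iff)

text \<open>
  The pure tensor \<open>b \<otimes> x\<close>, as a coset.
\<close>

definition tensor_elt ::
  "('s, 'r) ring_scheme \<Rightarrow> ('s, 'b) module \<Rightarrow> ('b \<Rightarrow> 's \<Rightarrow> 'b) \<Rightarrow> ('s, 'a) module
    \<Rightarrow> 'b \<Rightarrow> 'a \<Rightarrow> ('b \<times> 'a \<Rightarrow>\<^sub>0 int) set" where
  "tensor_elt R B ract M b x = tensor_null R B ract M #>\<^bsub>tensor_free B M\<^esub> frag_of (b, x)"

lemma keys_diff_subset:
  "\<lbrakk>Poly_Mapping.keys a \<subseteq> S; Poly_Mapping.keys b \<subseteq> S\<rbrakk> \<Longrightarrow> Poly_Mapping.keys (a - b) \<subseteq> S"
  for a b :: "'x \<Rightarrow>\<^sub>0 int"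
  using keys_diff[of a b] by blast

text \<open>
  The cosets of a subgroup \<open>H\<close> of a free abelian group do not depend on the generating set, so that
  the three sets occurring below (\<open>B \<times> M\<close>, \<open>B \<times> N\<close> and \<open>UNIV\<close>) can be interchanged.
\<close>

lemma r_coset_free: "H #>\<^bsub>free_Abelian_group S\<^esub> z = (\<lambda>h. h + z) ` H"
  by (auto simp: r_coset_def)

lemma subgroup_free_add:
  assumes "subgroup H (free_Abelian_group S)" "a \<in> H" "b \<in> H"
  shows "a + b \<in> H"
  using subgroup.m_closed[OF assms] by simp

lemma subgroup_free_uminus:
  assumes "subgroup H (free_Abelian_group S)" "a \<in> H"
  shows "- a \<in> H"
  using subgroup.m_inv_closed[OF assms] subgroup.mem_carrier[OF assms] by simp

lemma subgroup_free_zero: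
  assumes "subgroup H (free_Abelian_group S)"
  shows "0 \<in> H"
  using subgroup.one_closed[OF assms] by simp

lemma r_coset_free_absorb:
  assumes H: "subgroup H (free_Abelian_group S)" and h: "h \<in> H"
  shows "H #>\<^bsub>free_Abelian_group T\<^esub> (h + z) = H #>\<^bsub>free_Abelian_group T'\<^esub> z"
proof -
  have "(\<lambda>k. k + (h + z)) ` H = (\<lambda>k. k + z) ` H" (is "?L = ?R")
  proof
    show "?L \<subseteq> ?R"
      using subgroup_free_add[OF H _ h] by (force simp: add.assoc)
    show "?R \<subseteq> ?L"
    proof (rule image_subsetI)
      fix k assume "k \<in> H"
      then have "k + - h \<in> H" using subgroup_free_add[OF H] subgroup_free_uminus[OF H h] by blast
      then show "k + z \<in> ?L" by (rule rev_image_eqI) simp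
    qed
  qed
  then show ?thesis by (simp add: r_coset_free)
qed

lemma r_coset_free_eq:
  assumes H: "subgroup H (free_Abelian_group S)" and h: "a - b \<in> H"
  shows "H #>\<^bsub>free_Abelian_group T\<^esub> a = H #>\<^bsub>free_Abelian_group T'\<^esub> b"
  using r_coset_free_absorb[OF H h, of T b T'] by simp

text \<open>
  When the extension of \<open>\<phi>\<close> maps \<open>H'\<close> into \<open>H\<close>, all members of the union in \<^const>\<open>tensor_induced\<close>
  are equal.
\<close>

lemma tensor_induced_coset:
  assumes H: "subgroup H (free_Abelian_group S)" and H': "subgroup H' (free_Abelian_group S')"
    and sub: "\<And>h. h \<in> H' \<Longrightarrow> frag_extend (\<lambda>p. frag_of (\<phi> p)) h \<in> H"
  shows "tensor_induced H \<phi> (H' #>\<^bsub>free_Abelian_group T'\<^esub> z) =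
    H #>\<^bsub>free_Abelian_group T\<^esub> frag_extend (\<lambda>p. frag_of (\<phi> p)) z"
proof -
  let ?e = "frag_extend (\<lambda>p. frag_of (\<phi> p))"
  have "H #>\<^bsub>free_Abelian_group UNIV\<^esub> ?e (h + z) = H #>\<^bsub>free_Abelian_group T\<^esub> ?e z"
    if "h \<in> H'" for h
    unfolding frag_extend_add by (rule r_coset_free_absorb[OF H sub[OF that]])
  then show ?thesis
    using subgroup_free_zero[OF H'] unfolding tensor_induced_def r_coset_free[of T' H' z] by auto
qed

lemma frag_extend_generate:
  assumes gen: "\<And>x. x \<in> X \<Longrightarrow> frag_extend \<psi> x \<in> H"
    and X: "X \<subseteq> carrier (free_Abelian_group S)"
    and H: "subgroup H (free_Abelian_group T)"
    and z: "z \<in> generate (free_Abelian_group S) X"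
  shows "frag_extend \<psi> z \<in> H"
  using z
proof (induction rule: generate.induct)
  case one
  then show ?case using subgroup_free_zero[OF H] by simp
next
  case (incl h)
  then show ?case by (rule gen)
next
  case (inv h)
  then show ?case
    using X subgroup_free_uminus[OF H gen[OF inv]] by (auto simp: frag_extend_minus)
next
  case (eng a b)
  then show ?case using subgroup_free_add[OF H] by (simp add: frag_extend_add)
qed

context bimodule
begin

context
  fixes M :: "('s, 'a) module"
  assumes M: "left_module R M"
begin

interpretation M: left_module R M by (rule M)

private abbreviation (input) "null \<equiv> tensor_null R B ract M"
private abbreviation (input) "TM \<equiv> tensor_module R B ract M"
private abbreviation (input) "tn \<equiv> tensor_elt R B ract M"

lemma tensor_relations_carrier:
  "tensor_relations R B ract M \<subseteq> carrier (tensor_free B M)"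
proof
  fix p assume "p \<in> tensor_relations R B ract M"
  then show "p \<in> carrier (tensor_free B M)"
    unfolding tensor_relations_def
    by (elim UnE CollectE exE conjE)
      (simp_all add: keys_diff_subset keys_frag_of ract_closed M.smult_closed)
qed

lemma tensor_null_subgroup: "subgroup null (tensor_free B M)"
  unfolding tensor_null_def
  by (rule group.generate_is_subgroup[OF group_free_Abelian_group tensor_relations_carrier])

lemma tensor_null_normal: "null \<lhd> tensor_free B M"
  by (rule comm_group.subgroup_imp_normal[OF abelian_free_Abelian_group tensor_null_subgroup])

lemma tensor_module_sel:
  "carrier TM = carrier (tensor_free B M Mod null)"
  "\<zero>\<^bsub>TM\<^esub> = \<one>\<^bsub>tensor_free B M Mod null\<^esub>"
  "X \<oplus>\<^bsub>TM\<^esub> Y = X \<otimes>\<^bsub>tensor_free B M Mod null\<^esub> Y"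
  "r \<odot>\<^bsub>TM\<^esub> X = tensor_induced null (\<lambda>(b, x). (r \<odot>\<^bsub>B\<^esub> b, x)) X"
  by (simp_all add: tensor_module_def Let_def)

lemma tensor_abelian_group: "abelian_group TM"
proof -
  interpret Q: comm_group "tensor_free B M Mod null"
    by (rule comm_group.abelian_FactGroup[OF abelian_free_Abelian_group tensor_null_subgroup])
  show ?thesis
    by (rule abelian_groupI; unfold tensor_module_sel)
      (rule Q.m_closed Q.one_closed Q.m_assoc Q.m_comm Q.l_one Q.l_inv_ex; assumption)+
qed

lemma coset_hom: "(\<lambda>z. null #>\<^bsub>tensor_free B M\<^esub> z) \<in> hom (tensor_free B M) (add_monoid TM)"
  using normal.r_coset_hom_Mod[OF tensor_null_normal] by (simp add: hom_def tensor_module_sel)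

lemma tensor_module_cases:
  assumes "X \<in> carrier TM"
  obtains z where "Poly_Mapping.keys z \<subseteq> carrier B \<times> carrier M" "X = null #>\<^bsub>tensor_free B M\<^esub> z"
  using assms by (auto simp: tensor_module_sel FactGroup_def RCOSETS_def)

lemma tensor_elt_closed:
  "\<lbrakk>b \<in> carrier B; x \<in> carrier M\<rbrakk> \<Longrightarrow> tn b x \<in> carrier TM"
  using hom_in_carrier[OF coset_hom, of "frag_of (b, x)"] by (simp add: tensor_elt_def keys_frag_of)

lemma tensor_elt_eqI:
  assumes "b \<in> carrier B" "x \<in> carrier M" "b' \<in> carrier B" "x' \<in> carrier M"
    and "p - frag_of (b, x) - frag_of (b', x') \<in> tensor_relations R B ract M"
  shows "null #>\<^bsub>tensor_free B M\<^esub> p = tn b x \<oplus>\<^bsub>TM\<^esub> tn b' x'"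
proof -
  have "null #>\<^bsub>tensor_free B M\<^esub> p = null #>\<^bsub>tensor_free B M\<^esub> (frag_of (b, x) + frag_of (b', x'))"
    by (rule r_coset_free_eq[OF tensor_null_subgroup])
      (use assms(5) in \<open>auto simp: tensor_null_def diff_diff_eq intro: generate.incl\<close>)
  also have "\<dots> = tn b x \<oplus>\<^bsub>TM\<^esub> tn b' x'"
    using hom_mult[OF coset_hom, of "frag_of (b, x)" "frag_of (b', x')"] assms(1-4)
    by (simp add: tensor_elt_def keys_frag_of)
  finally show ?thesis .
qed

lemma tensor_elt_balanced: "balanced R B ract M TM tn"
  unfolding balanced_def
proof (intro conjI ballI)
  fix x assume x: "x \<in> carrier M"
  show "(\<lambda>b. tn b x) \<in> add_hom B TM"
  proof (rule add_homI)
    fix b b' assume b: "b \<in> carrier B" "b' \<in> carrier B"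
    show "tn (b \<oplus>\<^bsub>B\<^esub> b') x = tn b x \<oplus>\<^bsub>TM\<^esub> tn b' x"
      unfolding tensor_elt_def[of R B ract M "b \<oplus>\<^bsub>B\<^esub> b'"]
      by (rule tensor_elt_eqI) (use b x in \<open>auto simp: tensor_relations_def\<close>)
  qed (simp add: tensor_elt_closed x)
next
  fix b assume b: "b \<in> carrier B"
  show "tn b \<in> add_hom M TM"
  proof (rule add_homI)
    fix x x' assume x: "x \<in> carrier M" "x' \<in> carrier M"
    show "tn b (x \<oplus>\<^bsub>M\<^esub> x') = tn b x \<oplus>\<^bsub>TM\<^esub> tn b x'"
      unfolding tensor_elt_def[of R B ract M b "x \<oplus>\<^bsub>M\<^esub> x'"]
      by (rule tensor_elt_eqI) (use b x in \<open>auto simp: tensor_relations_def\<close>)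
  qed (simp add: tensor_elt_closed b)
next
  fix b r x assume "b \<in> carrier B" "r \<in> carrier R" "x \<in> carrier M"
  then show "tn (ract b r) x = tn b (r \<odot>\<^bsub>M\<^esub> x)"
    unfolding tensor_elt_def
    by (intro r_coset_free_eq[OF tensor_null_subgroup])
      (auto simp: tensor_null_def tensor_relations_def intro!: generate.incl)
qed

text \<open>
  Pure tensors generate: an additive map is determined by its values on them.
\<close>

lemma tensor_ext:
  fixes N :: "('t, 'c) module"
  assumes N: "abelian_group N" and h: "h \<in> add_hom TM N" and h': "h' \<in> add_hom TM N"
    and eq: "\<And>b x. \<lbrakk>b \<in> carrier B; x \<in> carrier M\<rbrakk> \<Longrightarrow> h (tn b x) = h' (tn b x)"
    and X: "X \<in> carrier TM"
  shows "h X = h' X"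
proof -
  let ?c = "\<lambda>z. null #>\<^bsub>tensor_free B M\<^esub> z"
  have hom: "(\<lambda>z. k (?c z)) \<in> hom (tensor_free B M) (add_monoid N)" if "k \<in> add_hom TM N" for k
    using Group.hom_compose[OF coset_hom that] by (simp add: comp_def)
  interpret T: group "tensor_free B M" by simp
  have grp: "group (add_monoid N)"
    using N by (simp add: abelian_group.a_group)
  interpret h: group_hom "tensor_free B M" "add_monoid N" "\<lambda>z. h (?c z)"
    by (intro group_hom.intro group_hom_axioms.intro grp hom h) simp
  interpret h': group_hom "tensor_free B M" "add_monoid N" "\<lambda>z. h' (?c z)"
    by (intro group_hom.intro group_hom_axioms.intro grp hom h') simp
  have "h (?c z) = h' (?c z)" if "Poly_Mapping.keys z \<subseteq> carrier B \<times> carrier M" for z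
    using that
  proof (rule free_Abelian_group_induct)
    show "h (?c 0) = h' (?c 0)" using h.hom_one h'.hom_one by simp
  next
    fix x y :: "'b \<times> 'a \<Rightarrow>\<^sub>0 int"
    assume k: "Poly_Mapping.keys x \<subseteq> carrier B \<times> carrier M"
      "Poly_Mapping.keys y \<subseteq> carrier B \<times> carrier M"
      and e: "h (?c x) = h' (?c x)" "h (?c y) = h' (?c y)"
    have "h (?c (x + - y)) = h' (?c (x + - y))"
      using h.hom_mult[of x "- y"] h'.hom_mult[of x "- y"] h.hom_inv[of y] h'.hom_inv[of y] k e
      by simp
    then show "h (?c (x - y)) = h' (?c (x - y))" by simp
  next
    fix p assume "p \<in> carrier B \<times> carrier M"
    then show "h (?c (frag_of p)) = h' (?c (frag_of p))"
      using eq[of "fst p" "snd p"] by (auto simp: tensor_elt_def)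
  qed
  then show ?thesis using X by (elim tensor_module_cases) simp
qed

text \<open>
  The universal property of the tensor product, existence part.
\<close>

lemma tensor_universal:
  fixes N :: "('s, 'c) module"
  assumes N: "abelian_group N" and g: "balanced R B ract M N g"
  obtains h where "h \<in> add_hom TM N"
    "\<And>b x. \<lbrakk>b \<in> carrier B; x \<in> carrier M\<rbrakk> \<Longrightarrow> h (tn b x) = g b x"
proof -
  interpret N: abelian_group N by fact
  obtain k where k: "k \<in> hom (tensor_free B M) (add_monoid N)"
    and kg: "\<And>p. p \<in> carrier B \<times> carrier M \<Longrightarrow> k (frag_of p) = (case p of (b, x) \<Rightarrow> g b x)"
    by (rule comm_group.free_Abelian_group_universal[OF N.a_comm_group,
          of "\<lambda>(b, x). g b x" "carrier B \<times> carrier M"])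
      (use balanced_closed[OF g] in auto)
  interpret k: group_hom "tensor_free B M" "add_monoid N" k
    by (intro group_hom.intro group_hom_axioms.intro k N.a_group) simp
  have kd: "k (x - y) = k x \<ominus>\<^bsub>N\<^esub> k y"
    if "Poly_Mapping.keys x \<subseteq> carrier B \<times> carrier M" "Poly_Mapping.keys y \<subseteq> carrier B \<times> carrier M"
    for x y
    using k.hom_mult[of x "- y"] k.hom_inv[of y] that by (simp add: a_minus_def a_inv_def)
  have cancel: "a \<oplus>\<^bsub>N\<^esub> b \<ominus>\<^bsub>N\<^esub> a \<ominus>\<^bsub>N\<^esub> b = \<zero>\<^bsub>N\<^esub>" if "a \<in> carrier N" "b \<in> carrier N" for a b
    using N.r_neg[of "a \<oplus>\<^bsub>N\<^esub> b"] that by (simp add: a_minus_def N.minus_add N.a_assoc)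
  have "k p = \<zero>\<^bsub>N\<^esub>" if "p \<in> tensor_relations R B ract M" for p
    using that balanced_closed[OF g] unfolding tensor_relations_def
    by (auto simp: kd kg keys_frag_of keys_diff_subset ract_closed M.smult_closed
        add_hom_add[OF balanced_left[OF g]] add_hom_add[OF balanced_right[OF g]]
        balanced_swap[OF g] cancel N.r_neg[folded a_minus_def])
  then have "tensor_relations R B ract M \<subseteq> kernel (tensor_free B M) (add_monoid N) k"
    using tensor_relations_carrier unfolding kernel_def by force
  then have "null \<subseteq> kernel (tensor_free B M) (add_monoid N) k"
    unfolding tensor_null_def
    by (intro group.generate_subgroup_incl[OF group_free_Abelian_group] k.subgroup_kernel)
  then obtain h where h: "h \<in> hom (tensor_free B M Mod null) (add_monoid N)"
    and hk: "\<And>x. x \<in> carrier (tensor_free B M) \<Longrightarrow> h (null #>\<^bsub>tensor_free B M\<^esub> x) = k x"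
    using k.FactGroup_universal_kernel[OF tensor_null_normal] by blast
  show thesis
  proof
    show "h \<in> add_hom TM N" using h by (simp add: hom_def tensor_module_sel)
    show "h (tn b x) = g b x" if "b \<in> carrier B" "x \<in> carrier M" for b x
      using that by (simp add: tensor_elt_def hk kg keys_frag_of)
  qed
qed

end

text \<open>
  The map \<open>u \<otimes> f\<close>. Both the left action of \<open>R\<close> on the tensor product (\<open>u\<close> a left multiplication,
  \<open>f\<close> the identity) and the functorial action (\<open>u\<close> the identity) are of this form.
\<close>

lemma tensor_induced_hom:
  fixes M :: "('s, 'a) module" and N :: "('s, 'c) module"
  assumes M: "left_module R M" and N: "left_module R N"
    and u: "u \<in> add_hom B B"
    and ur: "\<And>b r. \<lbrakk>b \<in> carrier B; r \<in> carrier R\<rbrakk> \<Longrightarrow> u (ract b r) = ract (u b) r"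
    and f: "f \<in> add_hom M N"
    and fr: "\<And>r x. \<lbrakk>r \<in> carrier R; x \<in> carrier M\<rbrakk> \<Longrightarrow> f (r \<odot>\<^bsub>M\<^esub> x) = r \<odot>\<^bsub>N\<^esub> f x"
  defines "I \<equiv> tensor_induced (tensor_null R B ract N) (\<lambda>(b, x). (u b, f x))"
  shows "I \<in> add_hom (tensor_module R B ract M) (tensor_module R B ract N)"
    and "\<lbrakk>b \<in> carrier B; x \<in> carrier M\<rbrakk> \<Longrightarrow>
      I (tensor_elt R B ract M b x) = tensor_elt R B ract N (u b) (f x)"
proof -
  let ?e = "frag_extend (\<lambda>p. frag_of (case p of (b, x) \<Rightarrow> (u b, f x)))"
  have rel: "?e p \<in> tensor_null R B ract N" if "p \<in> tensor_relations R B ract M" for p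
  proof -
    have "?e p \<in> tensor_relations R B ract N"
      using that unfolding tensor_relations_def
    proof (elim UnE CollectE exE conjE, goal_cases)
      case (1 b b' x)
      then show ?case
        using add_hom_closed[OF u] add_hom_add[OF u] add_hom_closed[OF f]
        by (simp add: frag_extend_diff) blast
    next
      case (2 b x x')
      then show ?case
        using add_hom_closed[OF u] add_hom_add[OF f] add_hom_closed[OF f]
        by (simp add: frag_extend_diff) blast
    next
      case (3 b r x)
      then show ?case
        using add_hom_closed[OF u] ur fr add_hom_closed[OF f]
        by (simp add: frag_extend_diff) blast
    qed
    then show ?thesis unfolding tensor_null_def by (rule generate.incl)
  qed
  have gen: "?e h \<in> tensor_null R B ract N" if "h \<in> tensor_null R B ract M" for h
    using frag_extend_generate[OF rel tensor_relations_carrier[OF M] tensor_null_subgroup[OF N]] that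
    unfolding tensor_null_def[of R B ract M] by blast
  have coset: "I (tensor_null R B ract M #>\<^bsub>tensor_free B M\<^esub> z) =
      tensor_null R B ract N #>\<^bsub>tensor_free B N\<^esub> ?e z" for z
    unfolding I_def
    by (rule tensor_induced_coset[OF tensor_null_subgroup[OF N] tensor_null_subgroup[OF M] gen])
  have keys: "Poly_Mapping.keys (?e z) \<subseteq> carrier B \<times> carrier N"
    if "Poly_Mapping.keys z \<subseteq> carrier B \<times> carrier M" for z
  proof
    fix q assume "q \<in> Poly_Mapping.keys (?e z)"
    then obtain p where "p \<in> Poly_Mapping.keys z" "q = (case p of (b, x) \<Rightarrow> (u b, f x))"
      using keys_frag_extend[of "\<lambda>p. frag_of (case p of (b, x) \<Rightarrow> (u b, f x))" z]
      by (auto simp: keys_frag_of)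
    then show "q \<in> carrier B \<times> carrier N"
      using that add_hom_closed[OF u] add_hom_closed[OF f] by (auto split: prod.splits)
  qed
  show "I \<in> add_hom (tensor_module R B ract M) (tensor_module R B ract N)"
  proof (rule add_homI)
    fix X assume "X \<in> carrier (tensor_module R B ract M)"
    then show "I X \<in> carrier (tensor_module R B ract N)"
      using hom_in_carrier[OF coset_hom[OF N]] keys
      by (elim tensor_module_cases[OF M]) (simp add: coset)
  next
    fix X Y assume "X \<in> carrier (tensor_module R B ract M)" "Y \<in> carrier (tensor_module R B ract M)"
    then obtain z w where z: "Poly_Mapping.keys z \<subseteq> carrier B \<times> carrier M"
        "X = tensor_null R B ract M #>\<^bsub>tensor_free B M\<^esub> z"
      and w: "Poly_Mapping.keys w \<subseteq> carrier B \<times> carrier M"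
        "Y = tensor_null R B ract M #>\<^bsub>tensor_free B M\<^esub> w"
      by (elim tensor_module_cases[OF M])
    show "I (X \<oplus>\<^bsub>tensor_module R B ract M\<^esub> Y) = I X \<oplus>\<^bsub>tensor_module R B ract N\<^esub> I Y"
      using hom_mult[OF coset_hom[OF M], of z w, symmetric]
        hom_mult[OF coset_hom[OF N], of "?e z" "?e w", symmetric] z w keys
      by (simp add: coset frag_extend_add)
  qed
  show "I (tensor_elt R B ract M b x) = tensor_elt R B ract N (u b) (f x)"
    if "b \<in> carrier B" "x \<in> carrier M"
    by (simp add: tensor_elt_def coset)
qed

lemma tensor_smult:
  assumes M: "left_module R M" and r: "r \<in> carrier R"
  shows "(\<lambda>X. r \<odot>\<^bsub>tensor_module R B ract M\<^esub> X)
      \<in> add_hom (tensor_module R B ract M) (tensor_module R B ract M)" (is ?hom)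
    and "\<lbrakk>b \<in> carrier B; x \<in> carrier M\<rbrakk> \<Longrightarrow>
      r \<odot>\<^bsub>tensor_module R B ract M\<^esub> tensor_elt R B ract M b x = tensor_elt R B ract M (r \<odot>\<^bsub>B\<^esub> b) x"
      (is "_ \<Longrightarrow> _ \<Longrightarrow> ?elt")
proof -
  have u: "(\<lambda>b. r \<odot>\<^bsub>B\<^esub> b) \<in> add_hom B B"
    using r by (simp add: add_hom_iff smult_closed smult_r_distr)
  note * = tensor_induced_hom[OF M M u, of "\<lambda>x. x"]
  show ?hom
    using *(1) r by (simp add: tensor_module_sel[OF M] smult_ract add_hom_iff)
  show ?elt if "b \<in> carrier B" "x \<in> carrier M"
    using *(2)[of b x] r that by (simp add: tensor_module_sel[OF M] smult_ract add_hom_iff)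
qed

lemma tensor_left_module:
  assumes M: "left_module R M"
  shows "left_module R (tensor_module R B ract M)" (is "left_module R ?T")
proof -
  interpret T: abelian_group ?T by (rule tensor_abelian_group[OF M])
  note hom = tensor_smult(1)[OF M] and elt = tensor_smult(2)[OF M]
  note ext = tensor_ext[OF M T.abelian_group_axioms]
  note tn = tensor_elt_closed[OF M]
  show ?thesis
  proof (intro left_module.intro left_module_axioms.intro)
    show "Ring.ring R" by (rule R.ring_axioms)
    show "abelian_group ?T" by (rule T.abelian_group_axioms)
    show "r \<odot>\<^bsub>?T\<^esub> X \<in> carrier ?T" if "r \<in> carrier R" "X \<in> carrier ?T" for r X
      using add_hom_closed[OF hom] that .
    show "r \<odot>\<^bsub>?T\<^esub> (X \<oplus>\<^bsub>?T\<^esub> Y) = r \<odot>\<^bsub>?T\<^esub> X \<oplus>\<^bsub>?T\<^esub> r \<odot>\<^bsub>?T\<^esub> Y"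
      if "r \<in> carrier R" "X \<in> carrier ?T" "Y \<in> carrier ?T" for r X Y
      using add_hom_add[OF hom] that .
    show "(r \<oplus>\<^bsub>R\<^esub> s) \<odot>\<^bsub>?T\<^esub> X = r \<odot>\<^bsub>?T\<^esub> X \<oplus>\<^bsub>?T\<^esub> s \<odot>\<^bsub>?T\<^esub> X"
      if rs: "r \<in> carrier R" "s \<in> carrier R" and X: "X \<in> carrier ?T" for r s X
    proof (rule ext[OF _ _ _ X])
      show "(\<lambda>X. (r \<oplus>\<^bsub>R\<^esub> s) \<odot>\<^bsub>?T\<^esub> X) \<in> add_hom ?T ?T" using hom rs by simp
      show "(\<lambda>X. r \<odot>\<^bsub>?T\<^esub> X \<oplus>\<^bsub>?T\<^esub> s \<odot>\<^bsub>?T\<^esub> X) \<in> add_hom ?T ?T"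
        using rs by (intro add_hom_plus T.abelian_group_axioms hom)
      fix b x assume "b \<in> carrier B" "x \<in> carrier M"
      then show "(r \<oplus>\<^bsub>R\<^esub> s) \<odot>\<^bsub>?T\<^esub> tensor_elt R B ract M b x =
          r \<odot>\<^bsub>?T\<^esub> tensor_elt R B ract M b x \<oplus>\<^bsub>?T\<^esub> s \<odot>\<^bsub>?T\<^esub> tensor_elt R B ract M b x"
        using rs add_hom_add[OF balanced_left[OF tensor_elt_balanced[OF M]]]
        by (simp add: elt smult_l_distr smult_closed)
    qed
    show "(r \<otimes>\<^bsub>R\<^esub> s) \<odot>\<^bsub>?T\<^esub> X = r \<odot>\<^bsub>?T\<^esub> (s \<odot>\<^bsub>?T\<^esub> X)"
      if rs: "r \<in> carrier R" "s \<in> carrier R" and X: "X \<in> carrier ?T" for r s X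
    proof (rule ext[OF _ _ _ X])
      show "(\<lambda>X. (r \<otimes>\<^bsub>R\<^esub> s) \<odot>\<^bsub>?T\<^esub> X) \<in> add_hom ?T ?T" using hom rs by simp
      show "(\<lambda>X. r \<odot>\<^bsub>?T\<^esub> (s \<odot>\<^bsub>?T\<^esub> X)) \<in> add_hom ?T ?T"
        using rs by (intro add_hom_comp[OF hom hom])
    qed (use rs in \<open>simp add: elt smult_assoc smult_closed\<close>)
    show "\<one>\<^bsub>R\<^esub> \<odot>\<^bsub>?T\<^esub> X = X" if X: "X \<in> carrier ?T" for X
    proof (rule ext[OF _ _ _ X])
      show "(\<lambda>X. \<one>\<^bsub>R\<^esub> \<odot>\<^bsub>?T\<^esub> X) \<in> add_hom ?T ?T" using hom by simp
      show "(\<lambda>X. X) \<in> add_hom ?T ?T" by (simp add: add_hom_iff)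
    qed (simp add: elt smult_one)
  qed
qed

lemma tensor_map_hom:
  assumes M: "left_module R M" and N: "left_module R N" and f: "f \<in> left_module_hom R M N"
  shows "tensor_map R B ract N f
      \<in> add_hom (tensor_module R B ract M) (tensor_module R B ract N)" (is ?hom)
    and "\<lbrakk>b \<in> carrier B; x \<in> carrier M\<rbrakk> \<Longrightarrow>
      tensor_map R B ract N f (tensor_elt R B ract M b x) = tensor_elt R B ract N b (f x)"
      (is "_ \<Longrightarrow> _ \<Longrightarrow> ?elt")
proof -
  have u: "(\<lambda>b. b) \<in> add_hom B B" by (simp add: add_hom_iff)
  have f': "f \<in> add_hom M N" using f by (simp add: left_module_hom_iff)
  note * = tensor_induced_hom[OF M N u _ f', folded tensor_map_def]
  show ?hom using *(1) left_module_hom_smult[OF f] by simp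
  show ?elt if "b \<in> carrier B" "x \<in> carrier M"
    using *(2)[of b x] left_module_hom_smult[OF f] that by simp
qed

end

section \<open>Transport of modules along injections\<close>

context
  fixes e :: "'x \<Rightarrow> 'u" and N :: "('s, 'x) module"
  assumes e: "inj_on e (carrier N)"
begin

lemma transport_module_sel:
  "carrier (transport_module e N) = e ` carrier N"
  "\<zero>\<^bsub>transport_module e N\<^esub> = e \<zero>\<^bsub>N\<^esub>"
  "\<lbrakk>x \<in> carrier N; y \<in> carrier N\<rbrakk> \<Longrightarrow> e x \<oplus>\<^bsub>transport_module e N\<^esub> e y = e (x \<oplus>\<^bsub>N\<^esub> y)"
  "x \<in> carrier N \<Longrightarrow> r \<odot>\<^bsub>transport_module e N\<^esub> e x = e (r \<odot>\<^bsub>N\<^esub> x)"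
  using e by (simp_all add: transport_module_def Let_def)

lemma transport_add_hom: "e \<in> add_hom N (transport_module e N)"
  by (rule add_homI) (simp_all add: transport_module_sel)

lemma transport_left_module:
  assumes N: "left_module R N"
  shows "left_module R (transport_module e N)"
proof -
  interpret N: left_module R N by fact
  show ?thesis
  proof (intro left_module.intro left_module_axioms.intro)
    show "abelian_group (transport_module e N)"
    proof (rule abelian_groupI)
      fix y assume "y \<in> carrier (transport_module e N)"
      then obtain x where x: "x \<in> carrier N" "y = e x" by (auto simp: transport_module_sel)
      then show "\<exists>z\<in>carrier (transport_module e N).
          z \<oplus>\<^bsub>transport_module e N\<^esub> y = \<zero>\<^bsub>transport_module e N\<^esub>"
        by (intro bexI[of _ "e (\<ominus>\<^bsub>N\<^esub> x)"]) (simp_all add: transport_module_sel N.l_neg)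
    qed (auto simp: transport_module_sel N.a_ac)
  qed (auto simp: transport_module_sel N.smult_closed N.smult_l_distr N.smult_r_distr
      N.smult_assoc N.smult_one N.R.ring_axioms)
qed

lemma transport_inv_add_hom:
  assumes N: "abelian_group N"
  shows "inv_into (carrier N) e \<in> add_hom (transport_module e N) N"
proof -
  interpret N: abelian_group N by fact
  show ?thesis
    by (rule add_homI) (use e in \<open>auto simp: transport_module_sel\<close>)
qed

end

section \<open>The functor of tensoring with a small bimodule\<close>

text \<open>
  Bimodules small enough for \<open>B \<otimes>\<^sub>R M\<close> to embed into \<open>'u\<close> whenever \<open>M\<close> is a subset of \<open>'u\<close>.
\<close>

locale small_bimodule = bimodule R B ract
  for R :: "('s, 'r) ring_scheme" (structure) and B :: "('s, 'b) module" (structure) and ract +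
  fixes universe :: "'u itself"
  assumes infinite_universe: "infinite (UNIV :: 'u set)"
    and small: "carrier B \<lesssim> (UNIV :: 'u set)"
begin

text \<open>
  The copy of \<open>B \<otimes>\<^sub>R M\<close> carried by a subset of \<open>'u\<close>, and the pure tensors in it. The lemmas below
  (\<open>pure_balanced\<close>, \<open>tens_ext\<close>, \<open>tens_universal\<close>, \<open>smult_pure\<close>) characterize it; the coding is
  not used beyond them.
\<close>

definition tens :: "('s, 'u) module \<Rightarrow> ('s, 'u) module" where
  "tens M = FOb (tensor_functor R B ract) M"

definition pure :: "('s, 'u) module \<Rightarrow> 'b \<Rightarrow> 'u \<Rightarrow> 'u" where
  "pure M b x = universe_code (carrier (tensor_module R B ract M)) (tensor_elt R B ract M b x)"

text \<open>
  \<open>B \<otimes>\<^sub>R M\<close> is a quotient of a subgroup of the free abelian group on \<open>B \<times> 'u\<close>, which has the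
  cardinality of \<open>'u\<close>.
\<close>

lemma tensor_module_small:
  fixes M :: "('s, 'u) module"
  assumes M: "left_module R M"
  shows "carrier (tensor_module R B ract M) \<lesssim> (UNIV :: 'u set)"
proof -
  let ?S = "carrier B \<times> (UNIV :: 'u set)"
  have "?S \<lesssim> (UNIV :: 'u set) \<times> (UNIV :: 'u set)"
    by (intro times_lepoll_mono small lepoll_refl)
  also have "\<dots> \<approx> (UNIV :: 'u set)"
    using card_of_Times_same_infinite[OF infinite_universe] eqpoll_iff_card_of_ordIso by blast
  finally have S: "?S \<lesssim> (UNIV :: 'u set)" .
  have "carrier B \<noteq> {}" by auto
  then have inf: "infinite ?S"
    using infinite_universe by (auto simp: finite_cartesian_product_iff)
  have "carrier (tensor_module R B ract M) \<lesssim> carrier (tensor_free B M)"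
    by (rule lepoll_trans[OF subset_imp_lepoll
          image_lepoll[of "\<lambda>z. tensor_null R B ract M #>\<^bsub>tensor_free B M\<^esub> z"]])
      (auto elim!: tensor_module_cases[OF M])
  also have "\<dots> \<lesssim> carrier (free_Abelian_group ?S)"
    by (rule subset_imp_lepoll) auto
  also have "\<dots> \<approx> ?S" by (rule eqpoll_free_Abelian_group_infinite[OF inf])
  also note S
  finally show ?thesis .
qed

lemma universe_code_inj:
  fixes M :: "('s, 'u) module"
  assumes "left_module R M"
  shows "inj_on (universe_code (carrier (tensor_module R B ract M)) :: _ \<Rightarrow> 'u)
    (carrier (tensor_module R B ract M))"
proof -
  have "\<exists>e :: _ \<Rightarrow> 'u. inj_on e (carrier (tensor_module R B ract M))"
    using tensor_module_small[OF assms] by (auto simp: lepoll_def)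
  then show ?thesis unfolding universe_code_def by (rule someI_ex)
qed

context
  fixes M :: "('s, 'u) module"
  assumes M: "left_module R M"
begin

private abbreviation (input) "TB \<equiv> tensor_module R B ract M"
private abbreviation (input) "code \<equiv> universe_code (carrier TB) :: _ \<Rightarrow> 'u"

lemma tens_eq: "tens M = transport_module code TB"
  by (simp add: tens_def tensor_functor_def Let_def)

lemma tens_left_module: "left_module R (tens M)"
  unfolding tens_eq
  by (rule transport_left_module[OF universe_code_inj[OF M] tensor_left_module[OF M]])

lemma code_add_hom: "code \<in> add_hom TB (tens M)"
  unfolding tens_eq by (rule transport_add_hom[OF universe_code_inj[OF M]])

lemma pure_balanced: "balanced R B ract M (tens M) (pure M)"
  using balanced_left[OF tensor_elt_balanced[OF M]] balanced_right[OF tensor_elt_balanced[OF M]]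
    balanced_swap[OF tensor_elt_balanced[OF M]]
  unfolding balanced_def pure_def[abs_def] by (auto intro!: add_hom_comp[OF code_add_hom])

lemma smult_pure:
  assumes "r \<in> carrier R" "b \<in> carrier B" "x \<in> carrier M"
  shows "r \<odot>\<^bsub>tens M\<^esub> pure M b x = pure M (r \<odot>\<^bsub>B\<^esub> b) x"
  using assms
  by (simp add: tens_eq pure_def transport_module_sel[OF universe_code_inj[OF M]]
      tensor_elt_closed[OF M] tensor_smult(2)[OF M])

lemma tens_ext:
  fixes N :: "('t, 'c) module"
  assumes N: "abelian_group N" and h: "h \<in> add_hom (tens M) N" and h': "h' \<in> add_hom (tens M) N"
    and eq: "\<And>b x. \<lbrakk>b \<in> carrier B; x \<in> carrier M\<rbrakk> \<Longrightarrow> h (pure M b x) = h' (pure M b x)"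
    and y: "y \<in> carrier (tens M)"
  shows "h y = h' y"
proof -
  obtain X where X: "X \<in> carrier TB" and y: "y = code X"
    using y by (auto simp: tens_eq transport_module_sel[OF universe_code_inj[OF M]])
  have "h (code X) = h' (code X)"
    by (rule tensor_ext[OF M N add_hom_comp[OF h code_add_hom] add_hom_comp[OF h' code_add_hom] _ X])
      (use eq in \<open>simp add: pure_def\<close>)
  then show ?thesis by (simp add: y)
qed

lemma tens_universal:
  fixes N :: "('s, 'c) module"
  assumes N: "abelian_group N" and g: "balanced R B ract M N g"
  obtains h where "h \<in> add_hom (tens M) N"
    "\<And>b x. \<lbrakk>b \<in> carrier B; x \<in> carrier M\<rbrakk> \<Longrightarrow> h (pure M b x) = g b x"
proof -
  obtain k where k: "k \<in> add_hom TB N"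
    and kg: "\<And>b x. \<lbrakk>b \<in> carrier B; x \<in> carrier M\<rbrakk> \<Longrightarrow> k (tensor_elt R B ract M b x) = g b x"
    using tensor_universal[OF M N g] by blast
  let ?i = "inv_into (carrier TB) code"
  have i: "?i \<in> add_hom (tens M) TB"
    unfolding tens_eq
    by (rule transport_inv_add_hom[OF universe_code_inj[OF M] tensor_abelian_group[OF M]])
  show thesis
    by (rule that[OF add_hom_comp[OF k i]])
      (simp add: pure_def kg tensor_elt_closed[OF M] inv_into_f_f[OF universe_code_inj[OF M]])
qed

lemma tens_hom_ext:
  fixes N :: "('s, 'c) module"
  assumes N: "left_module R N"
    and f: "f \<in> left_module_hom R (tens M) N" and g: "g \<in> left_module_hom R (tens M) N"
    and eq: "\<And>b x. \<lbrakk>b \<in> carrier B; x \<in> carrier M\<rbrakk> \<Longrightarrow> f (pure M b x) = g (pure M b x)"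
  shows "f = g"
  by (rule left_module_hom_ext[OF f g], rule tens_ext[OF _ left_module_hom_add_hom[OF f]
        left_module_hom_add_hom[OF g] eq])
    (use N in \<open>simp_all add: left_module_def\<close>)

text \<open>
  For an additive map, linearity need only be checked on pure tensors.
\<close>

lemma tens_homI:
  fixes N :: "('s, 'c) module"
  assumes N: "left_module R N" and h: "h \<in> add_hom (tens M) N"
    and ext: "h \<in> extensional (carrier (tens M))"
    and lin: "\<And>r b x. \<lbrakk>r \<in> carrier R; b \<in> carrier B; x \<in> carrier M\<rbrakk> \<Longrightarrow>
      h (pure M (r \<odot>\<^bsub>B\<^esub> b) x) = r \<odot>\<^bsub>N\<^esub> h (pure M b x)"
  shows "h \<in> left_module_hom R (tens M) N"
  unfolding left_module_hom_iff
proof (intro conjI ballI h ext)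
  interpret N: left_module R N by fact
  interpret T: left_module R "tens M" by (rule tens_left_module)
  fix r y assume r: "r \<in> carrier R" and y: "y \<in> carrier (tens M)"
  show "h (r \<odot>\<^bsub>tens M\<^esub> y) = r \<odot>\<^bsub>N\<^esub> h y"
  proof (rule tens_ext[OF N.M.abelian_group_axioms _ _ _ y])
    show "(\<lambda>y. h (r \<odot>\<^bsub>tens M\<^esub> y)) \<in> add_hom (tens M) N"
      using r by (intro add_hom_comp[OF h]) (simp add: add_hom_iff T.smult_closed T.smult_r_distr)
    show "(\<lambda>y. r \<odot>\<^bsub>N\<^esub> h y) \<in> add_hom (tens M) N"
      using r by (intro add_hom_comp[OF _ h]) (simp add: add_hom_iff N.smult_closed N.smult_r_distr)
  qed (use lin r in \<open>simp add: smult_pure\<close>)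
qed

end

text \<open>
  The map \<open>id \<otimes> f\<close> between the coded tensor products.
\<close>

definition tmap :: "('s, 'u) module \<Rightarrow> ('s, 'u) module \<Rightarrow> ('u \<Rightarrow> 'u) \<Rightarrow> 'u \<Rightarrow> 'u" where
  "tmap M N f = FMor (tensor_functor R B ract) M N f"

lemma
  assumes M: "left_module R M" and N: "left_module R N" and f: "f \<in> left_module_hom R M N"
  shows tmap_hom: "tmap M N f \<in> left_module_hom R (tens M) (tens N)" (is ?hom)
    and tmap_pure: "\<lbrakk>b \<in> carrier B; x \<in> carrier M\<rbrakk> \<Longrightarrow> tmap M N f (pure M b x) = pure N b (f x)"
      (is "_ \<Longrightarrow> _ \<Longrightarrow> ?pure b x")
proof -
  let ?T = "\<lambda>M. tensor_module R B ract M"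
  let ?code = "\<lambda>M. universe_code (carrier (?T M)) :: _ \<Rightarrow> 'u"
  let ?h = "\<lambda>y. ?code N (tensor_map R B ract N f (inv_into (carrier (?T M)) (?code M) y))"
  have eq: "tmap M N f = restrict ?h (carrier (tens M))"
    by (simp add: tmap_def tensor_functor_def Let_def tens_eq[OF M]
        transport_module_sel[OF universe_code_inj[OF M]])
  have "inv_into (carrier (?T M)) (?code M) \<in> add_hom (tens M) (?T M)"
    unfolding tens_eq[OF M]
    by (rule transport_inv_add_hom[OF universe_code_inj[OF M] tensor_abelian_group[OF M]])
  then have h: "?h \<in> add_hom (tens M) (tens N)"
    by (intro add_hom_comp[OF code_add_hom[OF N]] add_hom_comp[OF tensor_map_hom(1)[OF M N f]])
  interpret T: left_module R "tens M" by (rule tens_left_module[OF M])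
  have hom: "tmap M N f \<in> add_hom (tens M) (tens N)"
    using h by (simp add: eq add_hom_iff)
  have pure: "?pure b x" if "b \<in> carrier B" "x \<in> carrier M" for b x
    using that balanced_closed[OF pure_balanced[OF M]]
    by (simp add: eq) (simp add: pure_def inv_into_f_f[OF universe_code_inj[OF M]]
        tensor_elt_closed[OF M] tensor_map_hom(2)[OF M N f])
  show ?hom
  proof (rule tens_homI[OF M tens_left_module[OF N] hom])
    show "tmap M N f \<in> extensional (carrier (tens M))" by (simp add: eq)
  qed (simp add: pure smult_pure[OF N] smult_closed add_hom_closed[OF left_module_hom_add_hom[OF f]])
  show "?pure b x" if "b \<in> carrier B" "x \<in> carrier M"
    by (rule pure[OF that])
qed

lemma tensor_functor_is_func:
  "is_func (left_module_cat R) (left_module_cat R)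
    (tensor_functor R B ract :: (('s, 'u) module, 'u \<Rightarrow> 'u, ('s, 'u) module, 'u \<Rightarrow> 'u) func)"
  unfolding is_func_def
proof (intro conjI ballI is_category_left_module_cat; unfold left_module_cat_def cat.simps mem_Collect_eq
    tens_def[symmetric] tmap_def[symmetric])
  fix M :: "('s, 'u) module" assume M: "left_module R M"
  show "left_module R (tens M)" by (rule tens_left_module[OF M])
  note id = left_module_hom_id[OF M]
  show "tmap M M (\<lambda>x\<in>carrier M. x) = (\<lambda>x\<in>carrier (tens M). x)"
    by (rule tens_hom_ext[OF M tens_left_module[OF M] tmap_hom[OF M M id]
          left_module_hom_id[OF tens_left_module[OF M]]])
      (simp add: tmap_pure[OF M M id] balanced_closed[OF pure_balanced[OF M]])
next
  fix M N :: "('s, 'u) module" and f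
  assume "left_module R M" "left_module R N" "f \<in> left_module_hom R M N"
  then show "tmap M N f \<in> left_module_hom R (tens M) (tens N)" by (rule tmap_hom)
next
  fix L M N :: "('s, 'u) module" and f g
  assume L: "left_module R L" and M: "left_module R M" and N: "left_module R N"
    and f: "f \<in> left_module_hom R L M" and g: "g \<in> left_module_hom R M N"
  note gf = left_module_hom_comp[OF L f g]
  show "tmap L N (compose (carrier L) g f) = compose (carrier (tens L)) (tmap M N g) (tmap L M f)"
    by (rule tens_hom_ext[OF L tens_left_module[OF N] tmap_hom[OF L N gf]
          left_module_hom_comp[OF tens_left_module[OF L] tmap_hom[OF L M f] tmap_hom[OF M N g]]])
      (simp add: tmap_pure[OF L N gf] tmap_pure[OF L M f] tmap_pure[OF M N g] compose_eq
        balanced_closed[OF pure_balanced[OF L]] add_hom_closed[OF left_module_hom_add_hom[OF f]])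
qed

end

section \<open>Natural isomorphisms and equivalences\<close>

lemma is_func_id: "is_category C \<Longrightarrow> is_func C C id_func"
  by (simp add: is_func_def id_func_def is_category_def)

lemma is_func_comp: "\<lbrakk>is_func C D F; is_func D E G\<rbrakk> \<Longrightarrow> is_func C E (comp_func G F)"
  by (simp add: is_func_def comp_func_def)

lemma nat_iso_inverse:
  assumes F: "is_func C D F" and G: "is_func C D G" and e: "is_nat_iso C D F G \<epsilon>"
  obtains \<eta> where "is_nat_iso C D G F \<eta>"
proof -
  have D: "is_category D" using F by (simp add: is_func_def)
  have Fo: "FOb F A \<in> Ob D" and Go: "FOb G A \<in> Ob D" if "A \<in> Ob C" for A
    using F G that by (simp_all add: is_func_def)
  have Ff: "FMor F A B f \<in> Hom D (FOb F A) (FOb F B)" and Gf: "FMor G A B f \<in> Hom D (FOb G A) (FOb G B)"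
    if "A \<in> Ob C" "B \<in> Ob C" "f \<in> Hom C A B" for A B f
    using F G that by (simp_all add: is_func_def)
  have eps: "\<epsilon> A \<in> Hom D (FOb F A) (FOb G A)" if "A \<in> Ob C" for A
    using e that by (simp add: is_nat_iso_def is_iso_def)
  have "\<exists>g. g \<in> Hom D (FOb G A) (FOb F A) \<and>
      Cmp D (FOb F A) (FOb G A) (FOb F A) g (\<epsilon> A) = Id D (FOb F A) \<and>
      Cmp D (FOb G A) (FOb F A) (FOb G A) (\<epsilon> A) g = Id D (FOb G A)" if "A \<in> Ob C" for A
    using e that by (auto simp: is_nat_iso_def is_iso_def)
  then obtain \<eta> where eta: "\<eta> A \<in> Hom D (FOb G A) (FOb F A)"
    and l: "Cmp D (FOb F A) (FOb G A) (FOb F A) (\<eta> A) (\<epsilon> A) = Id D (FOb F A)"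
    and r: "Cmp D (FOb G A) (FOb F A) (FOb G A) (\<epsilon> A) (\<eta> A) = Id D (FOb G A)"
    if "A \<in> Ob C" for A
    by metis
  have assoc: "Cmp D X Y W h (Cmp D X X' Y g f) = Cmp D X X' W (Cmp D X' Y W h g) f"
    if "X \<in> Ob D" "X' \<in> Ob D" "Y \<in> Ob D" "W \<in> Ob D"
      "f \<in> Hom D X X'" "g \<in> Hom D X' Y" "h \<in> Hom D Y W" for X X' Y W f g h
    using D that by (simp add: is_category_def)
  have cmp: "Cmp D X X' Y g f \<in> Hom D X Y"
    if "X \<in> Ob D" "X' \<in> Ob D" "Y \<in> Ob D" "f \<in> Hom D X X'" "g \<in> Hom D X' Y" for X X' Y f g
    using D that by (simp add: is_category_def)
  have idl: "Cmp D X Y Y (Id D Y) f = f" and idr: "Cmp D X X Y f (Id D X) = f"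
    if "X \<in> Ob D" "Y \<in> Ob D" "f \<in> Hom D X Y" for X Y f
    using D that by (simp_all add: is_category_def)
  have "is_nat_iso C D G F \<eta>"
    unfolding is_nat_iso_def
  proof (intro conjI ballI)
    fix A assume A: "A \<in> Ob C"
    show "is_iso D (FOb G A) (FOb F A) (\<eta> A)"
      unfolding is_iso_def using eta[OF A] eps[OF A] l[OF A] r[OF A] by blast
  next
    fix A B f assume A: "A \<in> Ob C" and B: "B \<in> Ob C" and f: "f \<in> Hom C A B"
    note o = Fo[OF A] Go[OF A] Fo[OF B] Go[OF B]
    note h = Ff[OF A B f] Gf[OF A B f] eps[OF A] eps[OF B] eta[OF A] eta[OF B]
    have nat: "Cmp D (FOb F A) (FOb F B) (FOb G B) (\<epsilon> B) (FMor F A B f) =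
        Cmp D (FOb F A) (FOb G A) (FOb G B) (FMor G A B f) (\<epsilon> A)"
      using e A B f by (simp add: is_nat_iso_def)
    let ?a = "Cmp D (FOb F A) (FOb F B) (FOb G B) (\<epsilon> B) (FMor F A B f)"
    have "Cmp D (FOb G A) (FOb F A) (FOb F B) (FMor F A B f) (\<eta> A) =
        Cmp D (FOb G A) (FOb F A) (FOb F B)
          (Cmp D (FOb F A) (FOb F B) (FOb F B) (Id D (FOb F B)) (FMor F A B f)) (\<eta> A)"
      by (simp add: idl o h)
    also have "\<dots> = Cmp D (FOb G A) (FOb F A) (FOb F B)
          (Cmp D (FOb F A) (FOb G B) (FOb F B) (\<eta> B) ?a) (\<eta> A)"
      by (simp add: l[OF B, symmetric] assoc o h)
    also have "\<dots> = Cmp D (FOb G A) (FOb G B) (FOb F B) (\<eta> B)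
          (Cmp D (FOb G A) (FOb F A) (FOb G B) ?a (\<eta> A))"
      by (rule assoc[symmetric]) (simp_all add: o h cmp)
    also have "\<dots> = Cmp D (FOb G A) (FOb G B) (FOb F B) (\<eta> B)
          (Cmp D (FOb G A) (FOb G A) (FOb G B) (FMor G A B f) (Id D (FOb G A)))"
      by (simp add: nat r[OF A, symmetric] assoc o h)
    also have "\<dots> = Cmp D (FOb G A) (FOb G B) (FOb F B) (\<eta> B) (FMor G A B f)"
      by (simp add: idr o h)
    finally show "Cmp D (FOb G A) (FOb G B) (FOb F B) (\<eta> B) (FMor G A B f) =
        Cmp D (FOb G A) (FOb F A) (FOb F B) (FMor F A B f) (\<eta> A)" ..
  qed
  then show thesis by (rule that)
qed

text \<open>
  A functor whose square is naturally isomorphic to the identity is its own quasi-inverse.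
\<close>

lemma is_equivalence_involution:
  assumes F: "is_func C C F" and e: "is_nat_iso C C (comp_func F F) id_func \<epsilon>"
  shows "is_equivalence C C F"
proof -
  have C: "is_category C" using F by (simp add: is_func_def)
  obtain \<eta> where "is_nat_iso C C id_func (comp_func F F) \<eta>"
    using nat_iso_inverse[OF is_func_comp[OF F F] is_func_id[OF C] e] by blast
  then show ?thesis unfolding is_equivalence_def using F e by blast
qed

section \<open>Morita contexts\<close>

lemma add_hom_finsum:
  assumes M: "abelian_group M" and N: "abelian_group N" and h: "h \<in> add_hom M N"
    and f: "f \<in> A \<rightarrow> carrier M"
  shows "h (finsum M f A) = finsum N (\<lambda>i. h (f i)) A"
proof -
  interpret M: abelian_group M by fact
  interpret N: abelian_group N by fact
  have h0: "h \<zero>\<^bsub>M\<^esub> = \<zero>\<^bsub>N\<^esub>"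
  proof -
    have "h \<zero>\<^bsub>M\<^esub> \<oplus>\<^bsub>N\<^esub> h \<zero>\<^bsub>M\<^esub> = h \<zero>\<^bsub>M\<^esub>"
      using add_hom_add[OF h M.zero_closed M.zero_closed] by simp
    then show ?thesis
      using N.add.l_cancel_one[of "h \<zero>\<^bsub>M\<^esub>" "h \<zero>\<^bsub>M\<^esub>"] add_hom_closed[OF h M.zero_closed] by simp
  qed
  show ?thesis
    using f
  proof (induction A rule: infinite_finite_induct)
    case (infinite A)
    then show ?case by (simp add: h0)
  next
    case empty
    show ?case by (simp add: h0)
  next
    case (insert x F)
    then have "f \<in> F \<rightarrow> carrier M" "f x \<in> carrier M" by auto
    moreover from this have "(\<lambda>i. h (f i)) \<in> F \<rightarrow> carrier N" by (auto intro: add_hom_closed[OF h])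
    ultimately show ?case
      using insert by (simp add: add_hom_add[OF h] add_hom_closed[OF h])
  qed
qed

text \<open>
  A Morita context whose two rings are both \<open>R\<close> and whose two bimodules are both \<open>B\<close>: the map \<open>\<mu>\<close>
  induces a homomorphism of bimodules \<open>B \<otimes>\<^sub>R B \<rightarrow> R\<close> and satisfies \<open>a \<mu>(b, c) = \<mu>(a, b) c\<close>.
  Surjectivity of this homomorphism is given by a finite family with \<open>\<Sum>\<^sub>i \<mu>(p\<^sub>i, q\<^sub>i) = 1\<close>; finiteness
  of the index set is implied unless \<open>R\<close> is trivial, since \<^const>\<open>finsum\<close> vanishes on infinite sets.
\<close>

locale self_inverse_bimodule = small_bimodule R B ract universe
  for R :: "('s, 'r) ring_scheme" (structure) and B :: "('s, 'b) module" (structure)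
    and ract and universe :: "'u itself" +
  fixes \<mu> :: "'b \<Rightarrow> 'b \<Rightarrow> 's" and I :: "'i set" and p q :: "'i \<Rightarrow> 'b"
  assumes \<mu>_closed: "\<lbrakk>b \<in> carrier B; b' \<in> carrier B\<rbrakk> \<Longrightarrow> \<mu> b b' \<in> carrier R"
    and \<mu>_add_left: "\<lbrakk>b \<in> carrier B; b' \<in> carrier B; c \<in> carrier B\<rbrakk> \<Longrightarrow>
      \<mu> (b \<oplus>\<^bsub>B\<^esub> b') c = \<mu> b c \<oplus>\<^bsub>R\<^esub> \<mu> b' c"
    and \<mu>_add_right: "\<lbrakk>b \<in> carrier B; c \<in> carrier B; c' \<in> carrier B\<rbrakk> \<Longrightarrow>
      \<mu> b (c \<oplus>\<^bsub>B\<^esub> c') = \<mu> b c \<oplus>\<^bsub>R\<^esub> \<mu> b c'"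
    and \<mu>_balanced: "\<lbrakk>b \<in> carrier B; r \<in> carrier R; c \<in> carrier B\<rbrakk> \<Longrightarrow>
      \<mu> (ract b r) c = \<mu> b (r \<odot>\<^bsub>B\<^esub> c)"
    and \<mu>_left: "\<lbrakk>r \<in> carrier R; b \<in> carrier B; c \<in> carrier B\<rbrakk> \<Longrightarrow>
      \<mu> (r \<odot>\<^bsub>B\<^esub> b) c = r \<otimes>\<^bsub>R\<^esub> \<mu> b c"
    and \<mu>_right: "\<lbrakk>b \<in> carrier B; c \<in> carrier B; r \<in> carrier R\<rbrakk> \<Longrightarrow>
      \<mu> b (ract c r) = \<mu> b c \<otimes>\<^bsub>R\<^esub> r"
    and \<mu>_assoc: "\<lbrakk>a \<in> carrier B; b \<in> carrier B; c \<in> carrier B\<rbrakk> \<Longrightarrow>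
      ract a (\<mu> b c) = \<mu> a b \<odot>\<^bsub>B\<^esub> c"
    and p_closed: "i \<in> I \<Longrightarrow> p i \<in> carrier B" and q_closed: "i \<in> I \<Longrightarrow> q i \<in> carrier B"
    and finsum_\<mu>: "finsum R (\<lambda>i. \<mu> (p i) (q i)) I = \<one>\<^bsub>R\<^esub>"
begin

lemma finsum_smult:
  assumes "left_module R M" and "m \<in> carrier M"
  shows "finsum M (\<lambda>i. \<mu> (p i) (q i) \<odot>\<^bsub>M\<^esub> m) I = m"
proof -
  interpret M: left_module R M by fact
  have "(\<lambda>r. r \<odot>\<^bsub>M\<^esub> m) \<in> add_hom R M"
    using assms(2) by (intro add_homI) (simp_all add: M.smult_closed M.smult_l_distr)
  from add_hom_finsum[OF R.abelian_group_axioms M.M.abelian_group_axioms this, of "\<lambda>i. \<mu> (p i) (q i)" I]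
  show ?thesis
    using assms(2) by (simp add: finsum_\<mu> M.smult_one \<mu>_closed p_closed q_closed)
qed

lemma tens_tens_ext:
  fixes M :: "('s, 'u) module" and N :: "('s, 'c) module"
  assumes M: "left_module R M" and N: "left_module R N"
    and h: "h \<in> add_hom (tens (tens M)) N" and h': "h' \<in> add_hom (tens (tens M)) N"
    and eq: "\<And>b b' m. \<lbrakk>b \<in> carrier B; b' \<in> carrier B; m \<in> carrier M\<rbrakk> \<Longrightarrow>
      h (pure (tens M) b (pure M b' m)) = h' (pure (tens M) b (pure M b' m))"
    and z: "z \<in> carrier (tens (tens M))"
  shows "h z = h' z"
proof (rule tens_ext[OF tens_left_module[OF M] _ h h' _ z])
  have N': "abelian_group N" using N by (simp add: left_module_def)
  then show "abelian_group N" .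
  fix b y assume b: "b \<in> carrier B" and y: "y \<in> carrier (tens M)"
  note pb = balanced_right[OF pure_balanced[OF tens_left_module[OF M]] b]
  show "h (pure (tens M) b y) = h' (pure (tens M) b y)"
    by (rule tens_ext[OF M N' add_hom_comp[OF h pb] add_hom_comp[OF h' pb] _ y]) (rule eq[OF b])
qed

text \<open>
  The linear map \<open>B \<otimes> (B \<otimes> M) \<rightarrow> M\<close> sending \<open>b \<otimes> (b' \<otimes> m)\<close> to \<open>\<mu>(b, b') m\<close>. For fixed \<open>b\<close> the map
  \<open>(b', m) \<mapsto> \<mu>(b, b') m\<close> is balanced and yields \<open>k b : B \<otimes> M \<rightarrow> M\<close>; the map \<open>k\<close> is balanced in turn.
\<close>

lemma counit_exists:
  assumes M: "left_module R M"
  shows "\<exists>h. h \<in> left_module_hom R (tens (tens M)) M \<and>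
    (\<forall>b\<in>carrier B. \<forall>b'\<in>carrier B. \<forall>m\<in>carrier M.
      h (pure (tens M) b (pure M b' m)) = \<mu> b b' \<odot>\<^bsub>M\<^esub> m)"
proof -
  interpret M: left_module R M by fact
  interpret T: left_module R "tens M" by (rule tens_left_module[OF M])
  interpret TT: left_module R "tens (tens M)" by (rule tens_left_module[OF tens_left_module[OF M]])
  have "\<exists>k. k \<in> add_hom (tens M) M \<and>
      (\<forall>b'\<in>carrier B. \<forall>m\<in>carrier M. k (pure M b' m) = \<mu> b b' \<odot>\<^bsub>M\<^esub> m)" if b: "b \<in> carrier B" for b
  proof -
    have "balanced R B ract M M (\<lambda>b' m. \<mu> b b' \<odot>\<^bsub>M\<^esub> m)"
      using b by (simp add: balanced_def add_hom_iff M.smult_closed M.smult_l_distr M.smult_r_distr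
          \<mu>_closed \<mu>_add_right \<mu>_right M.smult_assoc)
    from tens_universal[OF M M.M.abelian_group_axioms this] show ?thesis by metis
  qed
  then obtain k where k: "\<And>b. b \<in> carrier B \<Longrightarrow> k b \<in> add_hom (tens M) M"
    and kp: "\<And>b b' m. \<lbrakk>b \<in> carrier B; b' \<in> carrier B; m \<in> carrier M\<rbrakk> \<Longrightarrow>
      k b (pure M b' m) = \<mu> b b' \<odot>\<^bsub>M\<^esub> m"
    by metis
  note ext = tens_ext[OF M M.M.abelian_group_axioms]
  have "balanced R B ract (tens M) M k"
    unfolding balanced_def
  proof (intro conjI ballI k)
    fix y assume y: "y \<in> carrier (tens M)"
    show "(\<lambda>b. k b y) \<in> add_hom B M"
    proof (rule add_homI)
      fix b c assume b: "b \<in> carrier B" and c: "c \<in> carrier B"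
      show "k (b \<oplus>\<^bsub>B\<^esub> c) y = k b y \<oplus>\<^bsub>M\<^esub> k c y"
        by (rule ext[OF _ add_hom_plus[OF M.M.abelian_group_axioms k[OF b] k[OF c]] _ y])
          (use b c in \<open>simp_all add: k kp \<mu>_add_left \<mu>_closed M.smult_l_distr\<close>)
    qed (simp add: add_hom_closed[OF k] y)
  next
    fix b r y assume b: "b \<in> carrier B" and r: "r \<in> carrier R" and y: "y \<in> carrier (tens M)"
    have ry: "(\<lambda>y. r \<odot>\<^bsub>tens M\<^esub> y) \<in> add_hom (tens M) (tens M)"
      using r by (simp add: add_hom_iff T.smult_closed T.smult_r_distr)
    show "k (ract b r) y = k b (r \<odot>\<^bsub>tens M\<^esub> y)"
      by (rule ext[OF k add_hom_comp[OF k ry] _ y])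
        (use b r in \<open>simp_all add: ract_closed kp smult_pure[OF M] smult_closed \<mu>_balanced\<close>)
  qed
  then obtain h where h: "h \<in> add_hom (tens (tens M)) M"
    and hp: "\<And>b y. b \<in> carrier B \<Longrightarrow> y \<in> carrier (tens M) \<Longrightarrow> h (pure (tens M) b y) = k b y"
    using tens_universal[OF tens_left_module[OF M] M.M.abelian_group_axioms] by metis
  note pure_closed = balanced_closed[OF pure_balanced[OF M]]
    balanced_closed[OF pure_balanced[OF tens_left_module[OF M]]]
  have hpp: "h (pure (tens M) b (pure M b' m)) = \<mu> b b' \<odot>\<^bsub>M\<^esub> m"
    if "b \<in> carrier B" "b' \<in> carrier B" "m \<in> carrier M" for b b' m
    using that by (simp add: hp kp pure_closed)
  let ?h = "restrict h (carrier (tens (tens M)))"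
  have "?h \<in> left_module_hom R (tens (tens M)) M"
  proof (rule tens_homI[OF tens_left_module[OF M] M])
    show "?h \<in> add_hom (tens (tens M)) M" using h by (simp add: add_hom_iff)
    fix r b y assume r: "r \<in> carrier R" and b: "b \<in> carrier B" and y: "y \<in> carrier (tens M)"
    have rM: "(\<lambda>m. r \<odot>\<^bsub>M\<^esub> m) \<in> add_hom M M"
      using r by (simp add: add_hom_iff M.smult_closed M.smult_r_distr)
    have "k (r \<odot>\<^bsub>B\<^esub> b) y = r \<odot>\<^bsub>M\<^esub> k b y"
      by (rule ext[OF k add_hom_comp[OF rM k] _ y])
        (use b r in \<open>simp_all add: smult_closed kp \<mu>_left \<mu>_closed M.smult_assoc\<close>)
    then show "?h (pure (tens M) (r \<odot>\<^bsub>B\<^esub> b) y) = r \<odot>\<^bsub>M\<^esub> ?h (pure (tens M) b y)"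
      using r b y by (simp add: pure_closed smult_closed hp)
  qed simp
  then show ?thesis
    by (intro exI[of _ ?h]) (simp add: hpp pure_closed)
qed

text \<open>
  The natural isomorphism from the square of the functor to the identity.
\<close>

definition counit :: "('s, 'u) module \<Rightarrow> 'u \<Rightarrow> 'u" where
  "counit M = (SOME h. h \<in> left_module_hom R (tens (tens M)) M \<and>
    (\<forall>b\<in>carrier B. \<forall>b'\<in>carrier B. \<forall>m\<in>carrier M.
      h (pure (tens M) b (pure M b' m)) = \<mu> b b' \<odot>\<^bsub>M\<^esub> m))"

lemma
  assumes "left_module R M"
  shows counit_hom: "counit M \<in> left_module_hom R (tens (tens M)) M"
    and counit_pure: "\<lbrakk>b \<in> carrier B; b' \<in> carrier B; m \<in> carrier M\<rbrakk> \<Longrightarrow>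
      counit M (pure (tens M) b (pure M b' m)) = \<mu> b b' \<odot>\<^bsub>M\<^esub> m"
  using someI_ex[OF counit_exists[OF assms]] unfolding counit_def by blast+

text \<open>
  Its inverse, \<open>m \<mapsto> \<Sum>\<^sub>i p\<^sub>i \<otimes> (q\<^sub>i \<otimes> m)\<close>.
\<close>

definition unit :: "('s, 'u) module \<Rightarrow> 'u \<Rightarrow> 'u" where
  "unit M = (\<lambda>m\<in>carrier M. finsum (tens (tens M)) (\<lambda>i. pure (tens M) (p i) (pure M (q i) m)) I)"

lemma
  assumes M: "left_module R M"
  shows unit_add_hom: "unit M \<in> add_hom M (tens (tens M))"
    and counit_unit: "m \<in> carrier M \<Longrightarrow> counit M (unit M m) = m"
    and unit_counit: "z \<in> carrier (tens (tens M)) \<Longrightarrow> unit M (counit M z) = z"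
proof -
  have B: "abelian_group B" by (rule M.abelian_group_axioms)
  interpret M: left_module R M by fact
  interpret T: left_module R "tens M" by (rule tens_left_module[OF M])
  interpret TT: left_module R "tens (tens M)" by (rule tens_left_module[OF tens_left_module[OF M]])
  note bal = pure_balanced[OF M] pure_balanced[OF tens_left_module[OF M]]
  note pure_closed = balanced_closed[OF bal(1)] balanced_closed[OF bal(2)]
  have pp: "(\<lambda>i. pure (tens M) (p i) (pure M (q i) m)) \<in> I \<rightarrow> carrier (tens (tens M))"
    if "m \<in> carrier M" for m
    using that by (simp add: pure_closed p_closed q_closed)
  show hom: "unit M \<in> add_hom M (tens (tens M))"
  proof (rule add_homI)
    fix x y assume x: "x \<in> carrier M" and y: "y \<in> carrier M"
    have "finsum (tens (tens M)) (\<lambda>i. pure (tens M) (p i) (pure M (q i) (x \<oplus>\<^bsub>M\<^esub> y))) I =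
      finsum (tens (tens M)) (\<lambda>i. pure (tens M) (p i) (pure M (q i) x) \<oplus>\<^bsub>tens (tens M)\<^esub>
        pure (tens M) (p i) (pure M (q i) y)) I"
      by (rule TT.finsum_cong'[OF refl])
        (use x y in \<open>auto simp: pure_closed p_closed q_closed add_hom_add[OF balanced_right[OF bal(1)]]
           add_hom_add[OF balanced_right[OF bal(2)]]\<close>)
    then show "unit M (x \<oplus>\<^bsub>M\<^esub> y) = unit M x \<oplus>\<^bsub>tens (tens M)\<^esub> unit M y"
      using x y by (simp add: unit_def TT.finsum_addf pp)
  qed (simp add: unit_def pp)
  note counit = left_module_hom_add_hom[OF counit_hom[OF M]]
  show "counit M (unit M m) = m" if m: "m \<in> carrier M"
  proof -
    have "counit M (unit M m) = finsum M (\<lambda>i. counit M (pure (tens M) (p i) (pure M (q i) m))) I"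
      using add_hom_finsum[OF TT.M.abelian_group_axioms M.M.abelian_group_axioms counit pp[OF m]] m
      by (simp add: unit_def)
    also have "\<dots> = finsum M (\<lambda>i. \<mu> (p i) (q i) \<odot>\<^bsub>M\<^esub> m) I"
      by (rule M.finsum_cong'[OF refl])
        (use m in \<open>auto simp: counit_pure[OF M] p_closed q_closed M.smult_closed \<mu>_closed\<close>)
    also have "\<dots> = m" by (rule finsum_smult[OF M m])
    finally show ?thesis .
  qed
  show "unit M (counit M z) = z" if z: "z \<in> carrier (tens (tens M))"
  proof (rule tens_tens_ext[OF M TT.left_module_axioms add_hom_comp[OF hom counit] _ _ z])
    show "(\<lambda>z. z) \<in> add_hom (tens (tens M)) (tens (tens M))" by (simp add: add_hom_iff)
    fix b b' m assume b: "b \<in> carrier B" and b': "b' \<in> carrier B" and m: "m \<in> carrier M"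
    let ?y = "pure M b' m"
    have y: "?y \<in> carrier (tens M)" by (simp add: pure_closed b' m)
    \<comment> \<open>\<open>p\<^sub>i \<otimes> (q\<^sub>i \<otimes> \<mu>(b, b') m) = \<mu>(p\<^sub>i, q\<^sub>i) b \<otimes> (b' \<otimes> m)\<close>: scalars cross both tensor signs, and
      associativity of \<open>\<mu>\<close> is used once for each of them\<close>
    have move: "pure (tens M) (p i) (pure M (q i) (\<mu> b b' \<odot>\<^bsub>M\<^esub> m)) =
        pure (tens M) (\<mu> (p i) (q i) \<odot>\<^bsub>B\<^esub> b) ?y" if i: "i \<in> I" for i
    proof -
      note c = p_closed[OF i] q_closed[OF i] b b' m
      have "pure M (q i) (\<mu> b b' \<odot>\<^bsub>M\<^esub> m) = pure M (ract (q i) (\<mu> b b')) m"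
        by (rule balanced_swap[OF bal(1), symmetric]) (simp_all add: c \<mu>_closed)
      also have "\<dots> = \<mu> (q i) b \<odot>\<^bsub>tens M\<^esub> ?y"
        by (simp add: c \<mu>_assoc \<mu>_closed smult_pure[OF M])
      also have "pure (tens M) (p i) \<dots> = pure (tens M) (ract (p i) (\<mu> (q i) b)) ?y"
        by (rule balanced_swap[OF bal(2), symmetric]) (simp_all add: c \<mu>_closed y)
      finally show ?thesis by (simp add: c \<mu>_assoc)
    qed
    have "unit M (counit M (pure (tens M) b ?y)) =
        finsum (tens (tens M)) (\<lambda>i. pure (tens M) (p i) (pure M (q i) (\<mu> b b' \<odot>\<^bsub>M\<^esub> m))) I"
      by (simp add: counit_pure[OF M] b b' m unit_def M.smult_closed \<mu>_closed)
    also have "\<dots> = finsum (tens (tens M)) (\<lambda>i. pure (tens M) (\<mu> (p i) (q i) \<odot>\<^bsub>B\<^esub> b) ?y) I"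
      by (rule TT.finsum_cong'[OF refl])
        (auto simp: move pure_closed y b p_closed q_closed \<mu>_closed smult_closed)
    also have "\<dots> = pure (tens M) (finsum B (\<lambda>i. \<mu> (p i) (q i) \<odot>\<^bsub>B\<^esub> b) I) ?y"
      by (rule add_hom_finsum[OF B TT.M.abelian_group_axioms
            balanced_left[OF bal(2) y], symmetric])
        (simp add: b p_closed q_closed \<mu>_closed smult_closed)
    also have "\<dots> = pure (tens M) b ?y"
      by (simp add: finsum_smult[OF left_module_axioms b])
    finally show "unit M (counit M (pure (tens M) b ?y)) = pure (tens M) b ?y" .
  qed
qed

text \<open>
  As the inverse of a linear map, \<open>unit M\<close> is linear.
\<close>

lemma unit_hom:
  assumes M: "left_module R M"
  shows "unit M \<in> left_module_hom R M (tens (tens M))"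
  unfolding left_module_hom_iff
proof (intro conjI ballI unit_add_hom[OF M])
  interpret M: left_module R M by fact
  interpret TT: left_module R "tens (tens M)" by (rule tens_left_module[OF tens_left_module[OF M]])
  fix r m assume r: "r \<in> carrier R" and m: "m \<in> carrier M"
  note z = add_hom_closed[OF unit_add_hom[OF M] m]
  have "counit M (r \<odot>\<^bsub>tens (tens M)\<^esub> unit M m) = r \<odot>\<^bsub>M\<^esub> m"
    using left_module_hom_smult[OF counit_hom[OF M] r z] by (simp add: counit_unit[OF M m])
  then show "unit M (r \<odot>\<^bsub>M\<^esub> m) = r \<odot>\<^bsub>tens (tens M)\<^esub> unit M m"
    using unit_counit[OF M TT.smult_closed[OF r z]] by simp
qed (simp add: unit_def)

theorem tensor_functor_equivalence:
  "is_equivalence (left_module_cat R) (left_module_cat R)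
    (tensor_functor R B ract :: (('s, 'u) module, 'u \<Rightarrow> 'u, ('s, 'u) module, 'u \<Rightarrow> 'u) func)"
proof (rule is_equivalence_involution[OF tensor_functor_is_func])
  show "is_nat_iso (left_module_cat R) (left_module_cat R)
      (comp_func (tensor_functor R B ract) (tensor_functor R B ract)) id_func counit"
    unfolding is_nat_iso_def
  proof (intro conjI ballI; unfold is_iso_def left_module_cat_def cat.simps mem_Collect_eq
      comp_func_def id_func_def func.simps tens_def[symmetric] tmap_def[symmetric])
    fix M :: "('s, 'u) module" assume M: "left_module R M"
    have "compose (carrier (tens (tens M))) (unit M) (counit M) = (\<lambda>z\<in>carrier (tens (tens M)). z)"
      by (auto simp: compose_def unit_counit[OF M])
    moreover have "compose (carrier M) (counit M) (unit M) = (\<lambda>m\<in>carrier M. m)"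
      by (auto simp: compose_def counit_unit[OF M])
    ultimately show "counit M \<in> left_module_hom R (tens (tens M)) M \<and>
        (\<exists>g\<in>left_module_hom R M (tens (tens M)).
          compose (carrier (tens (tens M))) g (counit M) = (\<lambda>x\<in>carrier (tens (tens M)). x) \<and>
          compose (carrier M) (counit M) g = (\<lambda>x\<in>carrier M. x))"
      using counit_hom[OF M] unit_hom[OF M] by blast
  next
    fix M N :: "('s, 'u) module" and f
    assume M: "left_module R M" and N: "left_module R N" and f: "f \<in> left_module_hom R M N"
    note TM = tens_left_module[OF M] and TN = tens_left_module[OF N]
    note Tf = tmap_hom[OF M N f]
    note TTf = tmap_hom[OF TM TN Tf]
    note l = left_module_hom_comp[OF tens_left_module[OF TM] TTf counit_hom[OF N]]
    note r = left_module_hom_comp[OF tens_left_module[OF TM] counit_hom[OF M] f]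
    note pure_closed = balanced_closed[OF pure_balanced[OF M]] balanced_closed[OF pure_balanced[OF TM]]
    show "compose (carrier (tens (tens M))) (counit N) (tmap (tens M) (tens N) (tmap M N f)) =
        compose (carrier (tens (tens M))) f (counit M)"
    proof (rule left_module_hom_ext[OF l r],
        rule tens_tens_ext[OF M N left_module_hom_add_hom[OF l] left_module_hom_add_hom[OF r]])
      fix b b' m assume "b \<in> carrier B" "b' \<in> carrier B" "m \<in> carrier M"
      then show "compose (carrier (tens (tens M))) (counit N) (tmap (tens M) (tens N) (tmap M N f))
          (pure (tens M) b (pure M b' m)) =
          compose (carrier (tens (tens M))) f (counit M) (pure (tens M) b (pure M b' m))"
        using add_hom_closed[OF left_module_hom_add_hom[OF f]]
        by (simp add: compose_eq pure_closed tmap_pure[OF TM TN Tf] tmap_pure[OF M N f]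
            counit_pure[OF M] counit_pure[OF N] left_module_hom_smult[OF f] \<mu>_closed)
    qed
  qed
qed

end

section \<open>The Schur algebra and its signed bimodule\<close>

lemma finite_power_lepoll:
  assumes "infinite (UNIV :: 'u set)"
  shows "(UNIV :: ('k::finite \<Rightarrow> 'u) set) \<lesssim> (UNIV :: 'u set)"
proof -
  have inf: "infinite (UNIV :: ('k \<times> 'u) set)"
    using assms by (simp add: finite_prod)
  have "(UNIV :: ('k \<Rightarrow> 'u) set) \<lesssim> Fpow (UNIV \<times> UNIV :: ('k \<times> 'u) set)"
    using lepoll_restricted_funspace[of UNIV UNIV "undefined :: 'k \<Rightarrow> 'u"] by simp
  also have "\<dots> \<approx> (UNIV \<times> UNIV :: ('k \<times> 'u) set)"
    using inf by (intro eqpoll_Fpow) simp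
  also have "\<dots> \<lesssim> (UNIV \<times> UNIV :: ('u \<times> 'u) set)"
    by (intro times_lepoll_mono finite_lepoll_infinite assms lepoll_refl) simp
  also have "\<dots> \<approx> (UNIV :: 'u set)"
    using card_of_Times_same_infinite[OF assms] eqpoll_iff_card_of_ordIso by blast
  finally show ?thesis .
qed

lemma linear_vec_iff:
  fixes f :: "('f::field) ^ 'k::finite \<Rightarrow> 'f ^ 'l::finite"
  shows "Vector_Spaces.linear (*s) (*s) f \<longleftrightarrow>
    (\<forall>x y. f (x + y) = f x + f y) \<and> (\<forall>c x. f (c *s x) = c *s f x)"
  by (simp add: Vector_Spaces.linear_iff vec.vector_space_axioms)

lemma equivariant_hom_iff:
  fixes h :: "('f::field) ^ 'k::finite \<Rightarrow> 'f ^ 'l::finite"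
  shows "h \<in> equivariant_hom \<rho> \<rho>' \<longleftrightarrow>
    (\<forall>x y. h (x + y) = h x + h y) \<and> (\<forall>c x. h (c *s x) = c *s h x) \<and>
    (\<forall>\<sigma>. \<sigma> permutes UNIV \<longrightarrow> (\<forall>x. h (\<rho> \<sigma> x) = \<rho>' \<sigma> (h x)))"
  by (auto simp: equivariant_hom_def linear_vec_iff)

lemma place_perm_linear:
  "place_perm \<sigma> (x + y) = place_perm \<sigma> x + place_perm \<sigma> y"
  "place_perm \<sigma> (c *s x) = c *s place_perm \<sigma> x"
  "place_perm \<sigma> 0 = 0"
  "place_perm \<sigma> (- x) = - place_perm \<sigma> x"
  by (simp_all add: place_perm_def vec_eq_iff)

lemma signed_place_perm_linear:
  "signed_place_perm \<sigma> (x + y) = signed_place_perm \<sigma> x + signed_place_perm \<sigma> y"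
  "signed_place_perm \<sigma> (c *s x) = c *s signed_place_perm \<sigma> x"
  "signed_place_perm \<sigma> 0 = 0"
  "signed_place_perm \<sigma> (- x) = - signed_place_perm \<sigma> x"
  by (simp_all add: signed_place_perm_def place_perm_def vec_eq_iff algebra_simps)

lemma equivariant_hom_closed:
  fixes g h :: "('f::field) ^ 'k::finite \<Rightarrow> 'f ^ 'l::finite"
  assumes \<rho>': "\<And>\<sigma> x y. \<rho>' \<sigma> (x + y) = \<rho>' \<sigma> x + \<rho>' \<sigma> y" "\<And>\<sigma>. \<rho>' \<sigma> 0 = 0"
    "\<And>\<sigma> x. \<rho>' \<sigma> (- x) = - \<rho>' \<sigma> x"
    and g: "g \<in> equivariant_hom \<rho> \<rho>'" and h: "h \<in> equivariant_hom \<rho> \<rho>'"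
  shows "(\<lambda>x. 0) \<in> equivariant_hom \<rho> \<rho>'"
    and "(\<lambda>x. g x + h x) \<in> equivariant_hom \<rho> \<rho>'"
    and "(\<lambda>x. - g x) \<in> equivariant_hom \<rho> \<rho>'"
  using assms by (simp_all add: equivariant_hom_iff add_ac vector_add_ldistrib vector_smult_rneg)

lemma schur_algebra_sel:
  "carrier schur_algebra = equivariant_hom place_perm place_perm"
  "g \<otimes>\<^bsub>schur_algebra\<^esub> h = g \<circ> h"
  "\<one>\<^bsub>schur_algebra\<^esub> = id"
  "\<zero>\<^bsub>schur_algebra\<^esub> = (\<lambda>x. 0)"
  "g \<oplus>\<^bsub>schur_algebra\<^esub> h = (\<lambda>x. g x + h x)"
  by (simp_all add: schur_algebra_def)

lemma schur_minus_sel: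
  "carrier schur_minus = equivariant_hom place_perm signed_place_perm"
  "\<zero>\<^bsub>schur_minus\<^esub> = (\<lambda>x. 0)"
  "g \<oplus>\<^bsub>schur_minus\<^esub> h = (\<lambda>x. g x + h x)"
  "s \<odot>\<^bsub>schur_minus\<^esub> h = s \<circ> h"
  by (simp_all add: schur_minus_def)

lemma schur_algebra_ring:
  "Ring.ring (schur_algebra :: ('f::field, 'n::finite, 'd::finite) tensor_endo ring)"
proof (rule ringI)
  show "abelian_group (schur_algebra :: ('f, 'n, 'd) tensor_endo ring)"
  proof (rule abelian_groupI; unfold schur_algebra_sel)
    fix g :: "('f, 'n, 'd) tensor_endo" assume "g \<in> equivariant_hom place_perm place_perm"
    then show "\<exists>h\<in>equivariant_hom place_perm place_perm. (\<lambda>x. h x + g x) = (\<lambda>x. 0)"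
      by (intro bexI[of _ "\<lambda>x. - g x"])
        (auto intro: equivariant_hom_closed simp: place_perm_linear)
  qed (auto simp: equivariant_hom_iff place_perm_linear vector_add_ldistrib add_ac)
  show "monoid (schur_algebra :: ('f, 'n, 'd) tensor_endo ring)"
    by (rule monoidI; unfold schur_algebra_sel) (auto simp: equivariant_hom_iff comp_assoc)
qed (auto simp: schur_algebra_sel equivariant_hom_iff fun_eq_iff)

lemma schur_minus_bimodule:
  "bimodule (schur_algebra :: ('f::field, 'n::finite, 'd::finite) tensor_endo ring)
    schur_minus (\<lambda>h s. h \<circ> s)"
proof (intro bimodule.intro bimodule_axioms.intro left_module.intro left_module_axioms.intro
    schur_algebra_ring)
  show "abelian_group (schur_minus :: (('f, 'n, 'd) tensor_endo, ('f, 'n, 'd) tensor_endo) module)"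
  proof (rule abelian_groupI; unfold schur_minus_sel)
    fix g :: "('f, 'n, 'd) tensor_endo" assume "g \<in> equivariant_hom place_perm signed_place_perm"
    then show "\<exists>h\<in>equivariant_hom place_perm signed_place_perm. (\<lambda>x. h x + g x) = (\<lambda>x. 0)"
      by (intro bexI[of _ "\<lambda>x. - g x"])
        (auto intro: equivariant_hom_closed simp: signed_place_perm_linear)
  qed (auto simp: equivariant_hom_iff signed_place_perm_linear vector_add_ldistrib add_ac)
qed (auto simp: schur_algebra_sel schur_minus_sel equivariant_hom_iff fun_eq_iff
    signed_place_perm_def)

lemma of_int_sign_square: "of_int (sign \<sigma>) * of_int (sign \<sigma>) = (1 :: 'a::ring_1)"
  by (simp add: sign_def)

text \<open>
  The two signs cancel, so that composition is a pairing on \<^const>\<open>schur_minus\<close> with values in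
  \<^const>\<open>schur_algebra\<close>.
\<close>

lemma schur_minus_comp:
  fixes g h :: "('f::field, 'n::finite, 'd::finite) tensor_endo"
  assumes "g \<in> equivariant_hom place_perm signed_place_perm"
    and "h \<in> equivariant_hom place_perm signed_place_perm"
  shows "g \<circ> h \<in> equivariant_hom place_perm place_perm"
  using assms
  by (simp add: equivariant_hom_iff signed_place_perm_def vector_smult_assoc of_int_sign_square)

text \<open>
  A linear map is determined by its matrix, a finite family of scalars.
\<close>

lemma schur_minus_small:
  assumes "infinite (UNIV :: 'u set)" and F: "(UNIV :: 'f::field set) \<lesssim> (UNIV :: 'u set)"
  shows "carrier (schur_minus :: (('f, 'n::finite, 'd::finite) tensor_endo, ('f, 'n, 'd) tensor_endo) module)
    \<lesssim> (UNIV :: 'u set)"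
proof -
  obtain e :: "'f \<Rightarrow> 'u" where e: "inj e" using F by (auto simp: lepoll_def)
  let ?entries = "\<lambda>(h :: ('f, 'n, 'd) tensor_endo) (i, j). e (h (axis j 1) $ i)"
  have "inj_on ?entries (carrier schur_minus)"
  proof (rule inj_onI)
    fix g h :: "('f, 'n, 'd) tensor_endo"
    assume g: "g \<in> carrier schur_minus" and h: "h \<in> carrier schur_minus" and eq: "?entries g = ?entries h"
    have lin: "Vector_Spaces.linear (*s) (*s) g" "Vector_Spaces.linear (*s) (*s) h"
      using g h by (simp_all add: schur_minus_sel equivariant_hom_def)
    interpret G: Vector_Spaces.linear "(*s)" "(*s)" g by (rule lin)
    interpret H: Vector_Spaces.linear "(*s)" "(*s)" h by (rule lin)
    have ax: "g (axis j 1) = h (axis j 1)" for j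
      using fun_cong[OF eq, of "(_, j)"] injD[OF e] by (auto simp: vec_eq_iff)
    show "g = h"
    proof
      fix x :: "('f, 'n, 'd) tensor_power"
      have "g (\<Sum>j\<in>UNIV. x $ j *s axis j 1) = h (\<Sum>j\<in>UNIV. x $ j *s axis j 1)"
        by (simp add: G.sum H.sum G.scale H.scale ax)
      then show "g x = h x" by (simp only: basis_expansion)
    qed
  qed
  then have "carrier (schur_minus :: (('f, 'n, 'd) tensor_endo, ('f, 'n, 'd) tensor_endo) module) \<lesssim>
      (UNIV :: (('d \<Rightarrow> 'n) \<times> ('d \<Rightarrow> 'n) \<Rightarrow> 'u) set)"
    unfolding lepoll_def by blast
  also have "\<dots> \<lesssim> (UNIV :: 'u set)" by (rule finite_power_lepoll[OF assms(1)])
  finally show ?thesis .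
qed

section \<open>The identity as a sum of composites of signed maps\<close>

text \<open>
  In terms of the basis vectors \<open>e i\<close> of the tensor power, this is the map
  \<open>x \<mapsto> \<Sum>\<^sub>\<sigma> sgn(\<sigma>) x(p \<circ> \<sigma>) e(q \<circ> \<sigma>)\<close>, the antisymmetrized matrix unit from \<open>e p\<close> to \<open>e q\<close>.
\<close>

definition signed_transfer ::
  "('d \<Rightarrow> 'n) \<Rightarrow> ('d \<Rightarrow> 'n) \<Rightarrow> ('f::field, 'n::finite, 'd::finite) tensor_endo" where
  "signed_transfer p q x =
    (\<chi> k. \<Sum>\<sigma> | \<sigma> permutes UNIV. of_int (sign \<sigma>) * x $ (p \<circ> \<sigma>) * (if k = q \<circ> \<sigma> then 1 else 0))"

lemma signed_transfer_schur_minus: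
  fixes p q :: "'d::finite \<Rightarrow> 'n::finite"
  shows "(signed_transfer p q :: ('f::field, 'n, 'd) tensor_endo) \<in> equivariant_hom place_perm signed_place_perm"
  unfolding equivariant_hom_iff
proof (intro conjI allI impI)
  fix \<rho> :: "'d \<Rightarrow> 'd" and x :: "('f, 'n, 'd) tensor_power"
  assume \<rho>: "\<rho> permutes UNIV"
  have surj: "k \<circ> \<rho> = k' \<circ> \<rho> \<longleftrightarrow> k = k'" for k k' :: "'d \<Rightarrow> 'n"
    using permutes_surj[OF \<rho>] by (metis fun.map_comp surj_iff comp_id)
  show "signed_transfer p q (place_perm \<rho> x) = signed_place_perm \<rho> (signed_transfer p q x)"
    unfolding vec_eq_iff
  proof
    fix k :: "'d \<Rightarrow> 'n"
    have "signed_place_perm \<rho> (signed_transfer p q x) $ k =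
      of_int (sign \<rho>) * (\<Sum>\<sigma> | \<sigma> permutes UNIV.
        of_int (sign \<sigma>) * x $ (p \<circ> \<sigma>) * (if k \<circ> \<rho> = q \<circ> \<sigma> then 1 else 0))"
      by (simp add: signed_place_perm_def place_perm_def signed_transfer_def)
    \<comment> \<open>substitute \<open>\<sigma> \<circ> \<rho>\<close> for \<open>\<sigma>\<close>\<close>
    also have "\<dots> = of_int (sign \<rho>) * (\<Sum>\<sigma> | \<sigma> permutes UNIV.
        of_int (sign (\<sigma> \<circ> \<rho>)) * x $ (p \<circ> (\<sigma> \<circ> \<rho>)) * (if k \<circ> \<rho> = q \<circ> (\<sigma> \<circ> \<rho>) then 1 else 0))"
      by (subst sum_permutations_compose_right[OF \<rho>]) simp
    also have "\<dots> = (\<Sum>\<sigma> | \<sigma> permutes UNIV.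
        of_int (sign \<sigma>) * x $ (p \<circ> \<sigma> \<circ> \<rho>) * (if k = q \<circ> \<sigma> then 1 else 0))"
      unfolding sum_distrib_left
    proof (intro sum.cong refl)
      fix \<sigma> :: "'d \<Rightarrow> 'd" assume "\<sigma> \<in> {\<sigma>. \<sigma> permutes UNIV}"
      then have "sign (\<sigma> \<circ> \<rho>) = sign \<sigma> * sign \<rho>"
        using \<rho> by (intro sign_compose permutation_permutes[THEN iffD2]) auto
      then show "of_int (sign \<rho>) * (of_int (sign (\<sigma> \<circ> \<rho>)) * x $ (p \<circ> (\<sigma> \<circ> \<rho>)) *
          (if k \<circ> \<rho> = q \<circ> (\<sigma> \<circ> \<rho>) then 1 else 0)) =
        of_int (sign \<sigma>) * x $ (p \<circ> \<sigma> \<circ> \<rho>) * (if k = q \<circ> \<sigma> then 1 else 0)"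
        using of_int_sign_square[of \<rho>, where 'a = 'f]
        by (simp add: comp_assoc[symmetric] surj)
    qed
    also have "\<dots> = signed_transfer p q (place_perm \<rho> x) $ k"
      by (simp add: signed_transfer_def place_perm_def)
    finally show "signed_transfer p q (place_perm \<rho> x) $ k =
      signed_place_perm \<rho> (signed_transfer p q x) $ k" ..
  qed
qed (simp_all add: signed_transfer_def vec_eq_iff algebra_simps sum.distrib sum_distrib_left)

text \<open>
  For injective \<open>\<iota>\<close> the maps \<open>\<iota> \<circ> \<sigma>\<close> are pairwise distinct, so that a single permutation contributes
  to each coordinate along the orbit of \<open>\<iota>\<close>.
\<close>

lemma signed_transfer_coordinate:
  assumes "inj \<iota>" and "\<sigma> permutes UNIV"
  shows "signed_transfer j \<iota> x $ (\<iota> \<circ> \<sigma>) = of_int (sign \<sigma>) * x $ (j \<circ> \<sigma>)"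
proof -
  have inj: "\<iota> \<circ> \<sigma> = \<iota> \<circ> \<tau> \<longleftrightarrow> \<tau> = \<sigma>" for \<tau>
    using fun.inj_map[OF assms(1)] by (auto simp: inj_def)
  have "finite {\<tau> :: 'd::finite \<Rightarrow> 'd. \<tau> permutes UNIV}" by simp
  then show ?thesis
    using assms(2) by (simp add: signed_transfer_def inj if_distrib sum.delta cong: if_cong)
qed

text \<open>
  Hence the composite \<open>e j \<rightarrow> e \<iota> \<rightarrow> e j\<close> is the unsigned map \<open>x \<mapsto> \<Sum>\<^sub>\<sigma> x(j \<circ> \<sigma>) e(j \<circ> \<sigma>)\<close>, and in the
  sum over all \<open>j\<close> each permutation contributes the identity.
\<close>

lemma sum_signed_transfer:
  fixes \<iota> :: "'d::finite \<Rightarrow> 'n::finite" and x :: "('f::field, 'n, 'd) tensor_power"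
  assumes \<iota>: "inj \<iota>"
  shows "(\<Sum>j\<in>UNIV. signed_transfer \<iota> j (signed_transfer j \<iota> x)) = of_nat (fact CARD('d)) *s x"
  unfolding vec_eq_iff
proof
  fix k :: "'d \<Rightarrow> 'n"
  let ?P = "{\<sigma> :: 'd \<Rightarrow> 'd. \<sigma> permutes UNIV}"
  have "(\<Sum>j\<in>UNIV. signed_transfer \<iota> j (signed_transfer j \<iota> x)) $ k =
      (\<Sum>j\<in>UNIV. \<Sum>\<sigma>\<in>?P. if k = j \<circ> \<sigma> then x $ (j \<circ> \<sigma>) else 0)"
    unfolding sum_component
  proof (rule sum.cong[OF refl])
    fix j :: "'d \<Rightarrow> 'n"
    have "of_int (sign \<sigma>) * (of_int (sign \<sigma>) * c) = c" for \<sigma> :: "'d \<Rightarrow> 'd" and c :: 'f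
      by (simp add: of_int_sign_square flip: mult.assoc)
    then show "signed_transfer \<iota> j (signed_transfer j \<iota> x) $ k =
        (\<Sum>\<sigma>\<in>?P. if k = j \<circ> \<sigma> then x $ (j \<circ> \<sigma>) else 0)"
      unfolding signed_transfer_def[of \<iota> j]
      by (auto intro!: sum.cong simp: signed_transfer_coordinate[OF \<iota>])
  qed
  also have "\<dots> = (\<Sum>\<sigma>\<in>?P. \<Sum>j\<in>UNIV. if k = j \<circ> \<sigma> then x $ (j \<circ> \<sigma>) else 0)"
    by (rule sum.swap)
  also have "\<dots> = (\<Sum>\<sigma>\<in>?P. x $ k)"
  proof (rule sum.cong[OF refl])
    fix \<sigma> assume "\<sigma> \<in> ?P"
    then have "bij \<sigma>" by (simp add: permutes_bij)
    then have eq: "k = j \<circ> \<sigma> \<longleftrightarrow> j = k \<circ> inv_into UNIV \<sigma>" for j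
      by (metis bij_is_inj bij_is_surj comp_assoc comp_id inj_iff surj_iff)
    have "(\<Sum>j\<in>UNIV. if k = j \<circ> \<sigma> then x $ (j \<circ> \<sigma>) else 0) =
        (\<Sum>j\<in>UNIV. if j = k \<circ> inv_into UNIV \<sigma> then x $ k else 0)"
      by (rule sum.cong[OF refl]) (auto simp flip: eq)
    then show "(\<Sum>j\<in>UNIV. if k = j \<circ> \<sigma> then x $ (j \<circ> \<sigma>) else 0) = x $ k"
      by simp
  qed
  also have "\<dots> = (of_nat (fact CARD('d)) *s x) $ k"
    by (simp add: card_permutations)
  finally show "(\<Sum>j\<in>UNIV. signed_transfer \<iota> j (signed_transfer j \<iota> x)) $ k =
    (of_nat (fact CARD('d)) *s x) $ k" .
qed

lemma of_nat_fact_nonzero: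
  assumes "CHAR('f::field) = 0 \<or> CHAR('f) > m"
  shows "of_nat (fact m) \<noteq> (0 :: 'f)"
proof
  assume "of_nat (fact m) = (0 :: 'f)"
  then have dvd: "CHAR('f) dvd fact m" by (simp only: of_nat_eq_0_iff_char_dvd)
  then have "CHAR('f) \<noteq> 0" by (metis dvd_0_left fact_nonzero)
  then have "prime CHAR('f)" and "CHAR('f) > m" using assms by (auto intro: prime_CHAR_semidom)
  then show False using dvd by (simp add: prime_dvd_fact_iff)
qed

lemma finsum_schur_algebra:
  fixes f :: "'i \<Rightarrow> ('f::field, 'n::finite, 'd::finite) tensor_endo"
  assumes "f \<in> I \<rightarrow> carrier schur_algebra" and "finite I"
  shows "finsum schur_algebra f I = (\<lambda>x. \<Sum>i\<in>I. f i x)"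
proof -
  interpret ring "schur_algebra :: ('f, 'n, 'd) tensor_endo ring" by (rule schur_algebra_ring)
  show ?thesis
    using assms(2,1)
  proof (induction I rule: finite_induct)
    case (insert i I)
    then have "finsum schur_algebra f (insert i I) = f i \<oplus>\<^bsub>schur_algebra\<^esub> finsum schur_algebra f I"
      by (intro finsum_insert) auto
    then show ?case using insert by (auto simp: schur_algebra_sel)
  qed (simp add: schur_algebra_sel)
qed

theorem theorem4p2:
  assumes "CHAR('f::field) \<noteq> 2"
    and "CHAR('f) = 0 \<or> CHAR('f) > CARD('d::finite)"
    and "CARD('n::finite) \<ge> CARD('d)"
    and "infinite (UNIV :: 'u set)"
    and "(UNIV :: 'f set) \<lesssim> (UNIV :: 'u set)"
  shows "is_equivalence
    (left_module_cat (schur_algebra :: ('f, 'n, 'd) tensor_endo ring))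
    (left_module_cat (schur_algebra :: ('f, 'n, 'd) tensor_endo ring))
    (koszul_duality_functor ::
      ((('f, 'n, 'd) tensor_endo, 'u) module, 'u \<Rightarrow> 'u,
       (('f, 'n, 'd) tensor_endo, 'u) module, 'u \<Rightarrow> 'u) func)"
proof -
  obtain \<iota> :: "'d \<Rightarrow> 'n" where \<iota>: "inj \<iota>"
    using inj_on_iff_card_le[of "UNIV :: 'd set" "UNIV :: 'n set"] assms(3) by auto
  define c :: 'f where "c = inverse (of_nat (fact CARD('d)))"
  have c: "c * of_nat (fact CARD('d)) = 1"
    using of_nat_fact_nonzero[OF assms(2)] by (simp add: c_def del: of_nat_fact)
  let ?p = "\<lambda>j x. c *s signed_transfer \<iota> j x :: ('f, 'n, 'd) tensor_power"
  let ?q = "\<lambda>j. signed_transfer j \<iota> :: ('f, 'n, 'd) tensor_endo"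
  have q: "?q j \<in> equivariant_hom place_perm signed_place_perm"
    and "signed_transfer \<iota> j \<in> equivariant_hom place_perm
      (signed_place_perm :: _ \<Rightarrow> ('f, 'n, 'd) tensor_endo)" for j
    by (rule signed_transfer_schur_minus)+
  then have p: "?p j \<in> equivariant_hom place_perm signed_place_perm" for j
    by (simp add: equivariant_hom_iff signed_place_perm_linear vector_add_ldistrib
        vector_smult_assoc mult.commute)
  interpret B: bimodule "schur_algebra :: ('f, 'n, 'd) tensor_endo ring" schur_minus "\<lambda>h s. h \<circ> s"
    by (rule schur_minus_bimodule)
  interpret self_inverse_bimodule "schur_algebra :: ('f, 'n, 'd) tensor_endo ring" schur_minus
    "\<lambda>h s. h \<circ> s" "TYPE('u)" "\<lambda>g h. g \<circ> h" UNIV ?p ?q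
  proof unfold_locales
    show "infinite (UNIV :: 'u set)" by fact
    show "carrier (schur_minus :: (('f, 'n, 'd) tensor_endo, ('f, 'n, 'd) tensor_endo) module)
      \<lesssim> (UNIV :: 'u set)"
      by (rule schur_minus_small[OF assms(4,5)])
    have "finsum (schur_algebra :: ('f, 'n, 'd) tensor_endo ring) (\<lambda>j. ?p j \<circ> ?q j) UNIV =
        (\<lambda>x. \<Sum>j\<in>UNIV. (?p j \<circ> ?q j) x)"
      by (rule finsum_schur_algebra) (use p q schur_minus_comp in \<open>auto simp: schur_algebra_sel\<close>)
    also have "\<dots> = id"
      by (rule ext) (simp add: sum_signed_transfer[OF \<iota>] vector_smult_assoc c
          del: of_nat_fact flip: vec.scale_sum_right)
    finally show "finsum (schur_algebra :: ('f, 'n, 'd) tensor_endo ring) (\<lambda>j. ?p j \<circ> ?q j) UNIV =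
        \<one>\<^bsub>schur_algebra :: ('f, 'n, 'd) tensor_endo ring\<^esub>"
      by (simp add: schur_algebra_sel)
    fix g h :: "('f, 'n, 'd) tensor_endo"
    assume "g \<in> carrier schur_minus" "h \<in> carrier schur_minus"
    then show "g \<circ> h \<in> carrier schur_algebra"
      by (simp add: schur_algebra_sel schur_minus_sel schur_minus_comp)
  next
    fix j :: "'d \<Rightarrow> 'n"
    show "?p j \<in> carrier schur_minus" by (simp add: schur_minus_sel p)
    show "?q j \<in> carrier schur_minus" by (simp add: schur_minus_sel q)
  qed (auto simp: schur_algebra_sel schur_minus_sel equivariant_hom_iff fun_eq_iff)
  show ?thesis
    unfolding koszul_duality_functor_def by (rule tensor_functor_equivalence)
qed

end
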